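(* Let $m\geq 1$ be an integer. For $R\in(0,\pi)$ let $\eta_{(m)}=\eta_{(m)}(R)$ be the $m$th eigenvalue (without counting multiplicity, numbering starting from $m=0$) of the second fourth-order Steklov problem on the closed geodesic disk of radius $R$ in the $2$-dimensional unit sphere $\mathbb{S}^2$. Then, as functions of $R$: (1) $\eta_{(m)}R$ is strictly increasing on $(0,\pi)$; (2) $\eta_{(m)}\sin R$ is strictly decreasing on $(0,\pi)$; (3) $\eta_{(m)}\tan(R/2)$ is strictly increasing on $(0,\pi)$; (4) for $m=1$, there exists an $R_1\in(0,\pi)$ such that $\eta_{(1)}\sin(R/2)$ is strictly decreasing on $(0,R_1)$ and strictly increasing on $(R_1,\pi)$; while for $m\geq 2$, $\eta_{(m)}\sin(R/2)$ is strictly increasing on $(0,\pi)$.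
   Context: The sphere $\mathbb{S}^2$ has constant curvature $+1$; the geodesic disk of radius $R$ carries the metric $dr^2+\sin^2 r\, g_{\mathbb{S}^1}$, $0\le r\le R$, where $r$ is the distance to the center. Second fourth-order Steklov problem: on a smooth compact Riemannian manifold $M$ with boundary $\partial M$ and outward unit normal $\nu$, a real number $\eta$ is an eigenvalue if there is a nontrivial $u$ with $$\Delta^2 u=0 \text{ in } M,\qquad u=0,\quad \Delta u=\eta\frac{\partial u}{\partial\nu} \text{ on } \partial M,$$ where $\Delta$ is the Laplace--Beltrami operator ($\Delta=\operatorname{div}\nabla$). The spectrum is discrete, positive and unbounded; the distinct eigenvalues (without counting multiplicity) are listed in increasing order as $0<\eta_{(0)}<\eta_{(1)}<\eta_{(2)}<\cdots$. *)

theory Defs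
  imports "HOL-Analysis.Analysis"
begin

text \<open>
  The sphere is \<^term>\<open>sphere (0::real^3) 1\<close> with the metric induced from \<^typ>\<open>real^3\<close>, so that
  the Levi-Civita connection is the tangential part of the ambient derivative. Functions and
  vector fields on the sphere are represented by functions on \<^typ>\<open>real^3\<close>. The operators below
  differentiate only in tangential directions, so their values at points of the sphere do
  not depend on how a smooth function is extended off the sphere.
\<close>

primrec Ck_on :: "nat \<Rightarrow> 'a::euclidean_space set \<Rightarrow> ('a \<Rightarrow> real) \<Rightarrow> bool" where
  "Ck_on 0 U f \<longleftrightarrow> continuous_on U f"
| "Ck_on (Suc k) U f \<longleftrightarrow>
     f differentiable_on U \<and> (\<forall>b\<in>Basis. Ck_on k U (\<lambda>x. frechet_derivative f (at x) b))"

text \<open>Smoothness up to the boundary of a compact set: a smooth extension to an open neighbourhood.\<close>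

definition smooth_near :: "'a::euclidean_space set \<Rightarrow> ('a \<Rightarrow> real) \<Rightarrow> bool" where
  "smooth_near M f \<longleftrightarrow> (\<exists>U. open U \<and> M \<subseteq> U \<and> (\<forall>k. Ck_on k U f))"

text \<open>Orthogonal projection to the tangent plane at \<open>p\<close> (for \<open>p\<close> of norm 1).\<close>

definition tproj :: "real^3 \<Rightarrow> real^3 \<Rightarrow> real^3" where
  "tproj p v = v - (p \<bullet> v) *\<^sub>R p"

definition sphere_grad :: "(real^3 \<Rightarrow> real) \<Rightarrow> real^3 \<Rightarrow> real^3" where
  "sphere_grad u p = (\<Sum>b\<in>Basis. frechet_derivative u (at p) (tproj p b) *\<^sub>R b)"

definition sphere_conn :: "(real^3 \<Rightarrow> real^3) \<Rightarrow> real^3 \<Rightarrow> real^3 \<Rightarrow> real^3" where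
  "sphere_conn X p v = tproj p (frechet_derivative X (at p) v)"

text \<open>
  The trace of the connection over the tangent plane, written as the trace over \<^typ>\<open>real^3\<close>
  after composing with the projection.
\<close>

definition sphere_div :: "(real^3 \<Rightarrow> real^3) \<Rightarrow> real^3 \<Rightarrow> real" where
  "sphere_div X p = (\<Sum>b\<in>Basis. sphere_conn X p (tproj p b) \<bullet> b)"

definition sphere_laplacian :: "(real^3 \<Rightarrow> real) \<Rightarrow> real^3 \<Rightarrow> real" where
  "sphere_laplacian u = sphere_div (sphere_grad u)"

text \<open>On the unit sphere, \<open>arccos (c \<bullet> p)\<close> is the geodesic distance from \<open>c\<close> to \<open>p\<close>.\<close>

definition geodesic_disk :: "real^3 \<Rightarrow> real \<Rightarrow> (real^3) set" where
  "geodesic_disk c R = {p \<in> sphere 0 1. arccos (c \<bullet> p) \<le> R}"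

definition geodesic_circle :: "real^3 \<Rightarrow> real \<Rightarrow> (real^3) set" where
  "geodesic_circle c R = {p \<in> sphere 0 1. arccos (c \<bullet> p) = R}"

text \<open>
  The velocity at distance \<open>R\<close> of the unit speed geodesic from \<open>c\<close> through \<open>p\<close>. The lemma
  characterises it as the outward unit normal: it is a unit vector tangent to the sphere,
  orthogonal to the tangent line of the circle, and the distance to \<open>c\<close> grows along it.
\<close>

definition disk_normal :: "real^3 \<Rightarrow> real \<Rightarrow> real^3 \<Rightarrow> real^3" where
  "disk_normal c R p = (1 / sin R) *\<^sub>R (cos R *\<^sub>R p - c)"

lemma disk_normal_outward_unit:
  assumes "norm c = 1" "R \<in> {0<..<pi}" "p \<in> geodesic_circle c R"
  shows "norm (disk_normal c R p) = 1"
    and "p \<bullet> disk_normal c R p = 0"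
    and "p \<bullet> v = 0 \<Longrightarrow> c \<bullet> v = 0 \<Longrightarrow> disk_normal c R p \<bullet> v = 0"
    and "c \<bullet> disk_normal c R p < 0"
proof -
  have sR: "sin R > 0" using assms(2) by (auto intro: sin_gt_zero)
  have p: "norm p = 1" and R: "arccos (c \<bullet> p) = R"
    using assms(3) by (auto simp: geodesic_circle_def)
  have "\<bar>c \<bullet> p\<bar> \<le> 1" using Cauchy_Schwarz_ineq2[of c p] assms(1) p by simp
  then have cp: "c \<bullet> p = cos R" using R cos_arccos_abs by metis
  have pp: "p \<bullet> p = 1" and cc: "c \<bullet> c = 1"
    using p assms(1) by (simp_all add: dot_square_norm)
  have sq: "(cos R)\<^sup>2 = 1 - (sin R)\<^sup>2" by (simp add: cos_squared_eq)
  have "(cos R *\<^sub>R p - c) \<bullet> (cos R *\<^sub>R p - c) = (sin R)\<^sup>2"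
    using cp pp cc sq by (simp add: inner_diff inner_commute power2_eq_square algebra_simps)
  then have "norm (cos R *\<^sub>R p - c) = sin R" using sR by (simp add: norm_eq_sqrt_inner)
  then show "norm (disk_normal c R p) = 1" using sR by (simp add: disk_normal_def)
  show "p \<bullet> disk_normal c R p = 0"
    using cp pp by (simp add: disk_normal_def inner_diff inner_commute)
  show "disk_normal c R p \<bullet> v = 0" if "p \<bullet> v = 0" "c \<bullet> v = 0"
    using that by (simp add: disk_normal_def inner_diff)
  have "c \<bullet> disk_normal c R p = - sin R"
    using cp cc sq sR
    by (simp add: disk_normal_def inner_diff power2_eq_square field_simps)
  then show "c \<bullet> disk_normal c R p < 0" using sR by simp
qed

definition steklov_eigenvalue :: "real^3 \<Rightarrow> real \<Rightarrow> real \<Rightarrow> bool" where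
  "steklov_eigenvalue c R \<eta> \<longleftrightarrow> (\<exists>u.
     smooth_near (geodesic_disk c R) u \<and>
     (\<exists>p\<in>geodesic_disk c R. u p \<noteq> 0) \<and>
     (\<forall>p\<in>geodesic_disk c R. sphere_laplacian (sphere_laplacian u) p = 0) \<and>
     (\<forall>p\<in>geodesic_circle c R.
        u p = 0 \<and>
        sphere_laplacian u p = \<eta> * frechet_derivative u (at p) (disk_normal c R p)))"

text \<open>The eigenvalues in increasing order, not counting multiplicity.\<close>

primrec steklov_eta :: "real^3 \<Rightarrow> nat \<Rightarrow> real \<Rightarrow> real" where
  "steklov_eta c 0 R = (LEAST \<eta>. steklov_eigenvalue c R \<eta>)"
| "steklov_eta c (Suc m) R = (LEAST \<eta>. steklov_eigenvalue c R \<eta> \<and> steklov_eta c m R < \<eta>)"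

end

(*
  Separate variables in geodesic polar coordinates (r, theta), with t = tan(r/2) and
  w = sin^2(r/2). The regular radial factor of a harmonic function of angular frequency m is
  t^m, and the solution of Delta u = t^m cos(m theta) vanishing on the circle is
  u = t^m (k(w) - k(w_R)) cos(m theta), where q = k' satisfies
  w (1 - w) q' + (m + 1 - 2 w) q = 1. The boundary condition then forces
  eta = eta_m(R) = 2 / (q(w_R) sin R). Conversely, if eta is none of these numbers, every Fourier
  mode of an eigenfunction vanishes, and so does the eigenfunction because trigonometric
  polynomials are dense. The power series of q has the coefficients
  (n+1)! m! / (n+m+1)!, so that q decreases in m and eta_m increases in m.

  Parts (2), (3) and (4) say how q, q (1 - w) and q sqrt(1 - w) vary with w, which is read off the
  signs of power series coefficients; for m = 1 the coefficients of the derivative in (4) change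
  sign once. For (1), the sign of the derivative of R / (q sin R) is that of Q - G, where
  Q = t^(2m) sin^2(R) q / 2 and G = R t^(2m) sin^2(R) / (sin R + R cos R + 2 m R); both vanish at
  R = 0, and Q' > G' amounts to 2 m (sin R - R cos R) > R - sin R cos R.
*)
theory Submission
  imports Defs
begin

section \<open>Smooth functions\<close>

text \<open>In s = log tan(r/2) one has d/ds = sin r d/dr, and sin^2 r times the Laplacian becomes
  d^2/ds^2 + d^2/dtheta^2. For this reason every radial equation below is a first-order system for a
  function y and its flux sin r y', which extends continuously to the pole, where the equation for y
  itself is singular. Since dw/ds = 2 w (1 - w), substituting t^m k(w) gives k_ss + 2 m k_s = sin^2
  r, which is the equation for q = k'. Because the eigenvalues are defined by LEAST among all real
  numbers, the spectrum has to be known exactly; hence the uniqueness of regular solutions and the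
  completeness of the Fourier modes. In (1), the equation for q reduces the claim to q > 2 R / (sin
  R + R cos R + 2 m R). Written in the variable R, that equation has the integrating factor t^(2m)
  sin^2(R), so Q' = t^(2m) sin R is free of q and the comparison of Q' with G' is between elementary
  functions.\<close>

lemma Ck_on_cong:
  assumes "open U" "\<And>x. x \<in> U \<Longrightarrow> f x = g x"
  shows "Ck_on k U f \<longleftrightarrow> Ck_on k U g"
  using assms(2)
proof (induction k arbitrary: f g)
  case 0
  then show ?case using continuous_on_cong[of U U f g] by simp
next
  case (Suc k)
  have D: "(f has_derivative D) (at x) \<longleftrightarrow> (g has_derivative D) (at x)" if "x \<in> U" for x D
    using has_derivative_transform_within_open[of f D x UNIV U g]
      has_derivative_transform_within_open[of g D x UNIV U f] that Suc.prems assms(1) by auto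
  then have fd: "frechet_derivative f (at x) = frechet_derivative g (at x)" if "x \<in> U" for x
    using that by (simp add: frechet_derivative_def)
  have "f differentiable_on U \<longleftrightarrow> g differentiable_on U"
    using D assms(1) by (simp add: differentiable_on_eq_differentiable_at differentiable_def)
  moreover have "Ck_on k U (\<lambda>x. frechet_derivative f (at x) b) \<longleftrightarrow>
      Ck_on k U (\<lambda>x. frechet_derivative g (at x) b)" for b
    by (rule Suc.IH) (simp add: fd)
  ultimately show ?case by simp
qed

lemma Ck_on_Suc_has_derivative:
  assumes "open U" "Ck_on (Suc k) U f" "x \<in> U"
  shows "(f has_derivative frechet_derivative f (at x)) (at x)"
  using assms frechet_derivative_works by (auto simp: differentiable_on_eq_differentiable_at)

text \<open>The derivative may be given by any formula \<open>D\<close>, so that the closure rules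
  below can take it from the product, inverse and chain rules.\<close>

lemma Ck_on_SucI:
  assumes "open U" "\<And>x. x \<in> U \<Longrightarrow> (f has_derivative D x) (at x)"
    "\<And>b. b \<in> Basis \<Longrightarrow> Ck_on k U (\<lambda>x. D x b)"
  shows "Ck_on (Suc k) U f"
proof -
  have fd: "frechet_derivative f (at x) = D x" if "x \<in> U" for x
    using frechet_derivative_at[OF assms(2)[OF that]] by simp
  have "f differentiable_on U"
    using assms(1,2) by (auto simp: differentiable_on_eq_differentiable_at differentiable_def)
  moreover have "Ck_on k U (\<lambda>x. frechet_derivative f (at x) b)" if "b \<in> Basis" for b
    using Ck_on_cong[OF assms(1), of "\<lambda>x. D x b" "\<lambda>x. frechet_derivative f (at x) b" k]
      assms(3)[OF that] fd by auto
  ultimately show ?thesis by simp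
qed

lemma Ck_on_continuous:
  assumes "Ck_on k U f" shows "continuous_on U f"
  using assms by (cases k) (auto intro: differentiable_imp_continuous_on)

lemma Ck_on_SucD:
  assumes "open U" "Ck_on (Suc k) U f" shows "Ck_on k U f"
  using assms(2)
proof (induction k arbitrary: f)
  case 0
  then show ?case by (auto intro: differentiable_imp_continuous_on)
next
  case (Suc k)
  show ?case
    by (rule Ck_on_SucI[OF assms(1) Ck_on_Suc_has_derivative[OF assms(1) Suc.prems]])
      (use Suc in auto)
qed

lemma Ck_on_const:
  assumes "open U" shows "Ck_on k U (\<lambda>x. a)"
  by (induction k arbitrary: a)
    (auto intro!: Ck_on_SucI[OF assms has_derivative_const] simp del: Ck_on.simps(2))

lemma Ck_on_frechet_derivative:
  "Ck_on (Suc k) U f \<Longrightarrow> b \<in> Basis \<Longrightarrow> Ck_on k U (\<lambda>x. frechet_derivative f (at x) b)"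
  by simp

lemma Ck_on_inner: "open U \<Longrightarrow> Ck_on k U (\<lambda>x. a \<bullet> x)"
proof (cases k)
  case (Suc j)
  assume U: "open U"
  have "Ck_on (Suc j) U (\<lambda>x. a \<bullet> x)"
    by (rule Ck_on_SucI[OF U, of _ "\<lambda>x h. a \<bullet> h"])
      (auto intro!: derivative_eq_intros simp: Ck_on_const[OF U])
  then show ?thesis using Suc by simp
qed (auto intro!: continuous_intros)

lemma Ck_on_add:
  assumes "open U" "Ck_on k U f" "Ck_on k U g" shows "Ck_on k U (\<lambda>x. f x + g x)"
  using assms(2,3)
proof (induction k arbitrary: f g)
  case (Suc k)
  show ?case
    by (rule Ck_on_SucI[OF assms(1) has_derivative_add])
      (rule Ck_on_Suc_has_derivative[OF assms(1)] Suc.IH Ck_on_frechet_derivative Suc.prems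
        | assumption)+
qed (auto intro: continuous_intros)

lemma Ck_on_mult:
  assumes "open U" "Ck_on k U f" "Ck_on k U g" shows "Ck_on k U (\<lambda>x. f x * g x)"
  using assms(2,3)
proof (induction k arbitrary: f g)
  case (Suc k)
  have "Ck_on k U f" "Ck_on k U g" using Suc.prems Ck_on_SucD assms(1) by blast+
  then show ?case
    by (intro Ck_on_SucI[OF assms(1) has_derivative_mult[OF Ck_on_Suc_has_derivative[OF assms(1) Suc.prems(1)]
            Ck_on_Suc_has_derivative[OF assms(1) Suc.prems(2)]]]
        Ck_on_add Suc.IH Ck_on_frechet_derivative Suc.prems assms(1))
qed (auto intro: continuous_intros)

lemma Ck_on_minus:
  assumes "open U" "Ck_on k U f" shows "Ck_on k U (\<lambda>x. - f x)"
  using Ck_on_mult[OF assms(1) Ck_on_const[OF assms(1), where a="-1"] assms(2)] by simp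

lemma Ck_on_diff:
  assumes "open U" "Ck_on k U f" "Ck_on k U g" shows "Ck_on k U (\<lambda>x. f x - g x)"
  using Ck_on_add[OF assms(1,2) Ck_on_minus[OF assms(1,3)]] by simp

lemma Ck_on_sum:
  assumes "open U" "\<And>i. i \<in> I \<Longrightarrow> Ck_on k U (f i)" shows "Ck_on k U (\<lambda>x. \<Sum>i\<in>I. f i x)"
  using assms(2)
  by (induction I rule: infinite_finite_induct)
    (auto intro!: Ck_on_add assms(1) simp: Ck_on_const[OF assms(1)])

lemma Ck_on_power:
  assumes "open U" "Ck_on k U f" shows "Ck_on k U (\<lambda>x. f x ^ n)"
  by (induction n) (auto intro!: Ck_on_mult Ck_on_const assms)

lemma Ck_on_inverse:
  assumes "open U" "Ck_on k U f" "\<And>x. x \<in> U \<Longrightarrow> f x \<noteq> 0" shows "Ck_on k U (\<lambda>x. inverse (f x))"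
  using assms(2)
proof (induction k)
  case (Suc k)
  have "Ck_on k U (\<lambda>x. inverse (f x))" using Suc Ck_on_SucD assms(1) by blast
  then show ?case
    by (intro Ck_on_SucI[OF assms(1) Deriv.has_derivative_inverse[OF assms(3)
            Ck_on_Suc_has_derivative[OF assms(1) Suc.prems]]]
        Ck_on_mult Ck_on_minus Ck_on_frechet_derivative Suc.prems assms(1))
qed (use assms(3) in \<open>auto intro!: continuous_intros\<close>)

text \<open>\<open>\<phi>\<close> is a whole sequence of successive derivatives: differentiating
  \<open>\<phi> n\<close> composed with \<open>g\<close> brings in \<open>\<phi> (Suc n)\<close>, so
  the induction must vary \<open>n\<close>. It is applied to the termwise derivatives of a power
  series.\<close>

lemma Ck_on_compose_real:
  assumes "open U" "Ck_on k U g" "open S" "g ` U \<subseteq> S"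
    "\<And>n x. x \<in> S \<Longrightarrow> (\<phi> n has_real_derivative \<phi> (Suc n) x) (at x)"
  shows "Ck_on k U (\<lambda>x. \<phi> n (g x))"
  using assms(2)
proof (induction k arbitrary: n)
  case 0
  have "continuous_on S (\<phi> n)"
    using DERIV_isCont[OF assms(5)] assms(3) by (simp add: continuous_on_eq_continuous_at)
  then show ?case
    using 0 assms(4) continuous_on_compose2 by (metis Ck_on.simps(1))
next
  case (Suc k)
  have g: "Ck_on k U g" using Suc.prems Ck_on_SucD assms(1) by blast
  have "((\<lambda>x. \<phi> n (g x)) has_derivative (\<lambda>h. frechet_derivative g (at x) h * \<phi> (Suc n) (g x))) (at x)"
    if "x \<in> U" for x
  proof -
    have "(\<phi> n has_derivative (\<lambda>h. h * \<phi> (Suc n) (g x))) (at (g x))"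
      using assms(5)[of "g x" n] assms(4) that
      by (auto simp: has_field_derivative_def mult_commute_abs)
    then show ?thesis
      using has_derivative_compose[OF Ck_on_Suc_has_derivative[OF assms(1) Suc.prems that]] by blast
  qed
  then show ?case
    by (rule Ck_on_SucI[OF assms(1)]) (use Suc.prems g in \<open>auto intro!: Ck_on_mult assms(1) Suc.IH\<close>)
qed

section \<open>The Laplacian of the sphere in geodesic polar coordinates\<close>

lemma inner_eq_sum_Basis: "(x::'a::euclidean_space) \<bullet> y = (\<Sum>b\<in>Basis. (b \<bullet> x) * (b \<bullet> y))"
  by (subst euclidean_inner) (simp add: inner_commute)

lemma orthonormal_expand3:
  fixes f1 f2 f3 v :: "real^3"
  assumes "f1 \<bullet> f1 = 1" "f2 \<bullet> f2 = 1" "f3 \<bullet> f3 = 1" "f1 \<bullet> f2 = 0" "f1 \<bullet> f3 = 0" "f2 \<bullet> f3 = 0"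
  shows "v = (v \<bullet> f1) *\<^sub>R f1 + (v \<bullet> f2) *\<^sub>R f2 + (v \<bullet> f3) *\<^sub>R f3"
proof -
  let ?S = "{f1, f2, f3}"
  have ne: "f1 \<noteq> f2" "f1 \<noteq> f3" "f2 \<noteq> f3" using assms by auto
  have orth: "pairwise orthogonal ?S"
    using assms by (auto simp: pairwise_def orthogonal_def inner_commute)
  have "0 \<notin> ?S" using assms by auto
  then have ind: "independent ?S" by (rule pairwise_orthogonal_independent[OF orth])
  have "dim ?S = 3" using dim_eq_card_independent[OF ind] ne by simp
  then have "span ?S = UNIV" using dim_eq_full[of ?S] by simp
  then have "(\<Sum>i\<in>?S. (v \<bullet> i) *\<^sub>R i) = v"
    by (intro orthonormal_basis_expand[OF orth]) (use assms in \<open>auto simp: norm_eq_1\<close>)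
  then show ?thesis using ne by (simp add: add.assoc)
qed

text \<open>A trace may be computed in any orthonormal basis. \<open>tproj\<close> on both sides of
  the derivative removes the direction \<open>p\<close>, so a frame of the tangent plane
  suffices.\<close>

lemma sphere_div_orthonormal:
  fixes p f1 f2 :: "real^3"
  assumes on: "p \<bullet> p = 1" "f1 \<bullet> f1 = 1" "f2 \<bullet> f2 = 1" "p \<bullet> f1 = 0" "p \<bullet> f2 = 0" "f1 \<bullet> f2 = 0"
    and X: "(X has_derivative X') (at p)"
  shows "sphere_div X p = X' f1 \<bullet> f1 + X' f2 \<bullet> f2"
proof -
  have X': "frechet_derivative X (at p) = X'" using frechet_derivative_at[OF X] by simp
  interpret X': bounded_linear X' using X by (rule has_derivative_bounded_linear)
  have P: "tproj p v = (v \<bullet> f1) *\<^sub>R f1 + (v \<bullet> f2) *\<^sub>R f2" for v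
    using orthonormal_expand3[of p f1 f2 v] on unfolding tproj_def
    by (simp add: inner_commute algebra_simps)
  \<comment> \<open>Both projections are expanded in \<open>f1\<close> and \<open>f2\<close>; the
    sum over \<open>b\<close> then reproduces the inner products of \<open>f1\<close> and
    \<open>f2\<close>.\<close>
  have "sphere_conn X p (tproj p b) \<bullet> b =
      (X' f1 \<bullet> f1) * ((b \<bullet> f1) * (b \<bullet> f1)) + (X' f1 \<bullet> f2) * ((b \<bullet> f1) * (b \<bullet> f2)) +
      (X' f2 \<bullet> f1) * ((b \<bullet> f2) * (b \<bullet> f1)) + (X' f2 \<bullet> f2) * ((b \<bullet> f2) * (b \<bullet> f2))" for b
    unfolding sphere_conn_def X' P X'.add X'.scaleR
    by (simp add: inner_commute inner_add_left inner_add_right algebra_simps)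
  then have "sphere_div X p =
      (X' f1 \<bullet> f1) * (f1 \<bullet> f1) + (X' f1 \<bullet> f2) * (f1 \<bullet> f2) +
      (X' f2 \<bullet> f1) * (f2 \<bullet> f1) + (X' f2 \<bullet> f2) * (f2 \<bullet> f2)"
    unfolding sphere_div_def inner_eq_sum_Basis[of f1 f1] inner_eq_sum_Basis[of f1 f2]
      inner_eq_sum_Basis[of f2 f1] inner_eq_sum_Basis[of f2 f2]
    by (simp only: sum.distrib sum_distrib_left)
  then show ?thesis using on by (simp add: inner_commute)
qed

text \<open>\<open>Ck_on\<close> speaks of real-valued functions only, so the gradient is
  differentiated through its components in the standard basis.\<close>

definition sphere_grad_component :: "(real^3 \<Rightarrow> real) \<Rightarrow> real^3 \<Rightarrow> real^3 \<Rightarrow> real" where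
  "sphere_grad_component f b p = frechet_derivative f (at p) (tproj p b)"

lemma sphere_grad_eq: "sphere_grad f p = (\<Sum>b\<in>Basis. sphere_grad_component f b p *\<^sub>R b)"
  by (simp add: sphere_grad_def sphere_grad_component_def)

lemma bounded_linear_eq_sum_Basis:
  fixes f :: "'a::euclidean_space \<Rightarrow> real"
  assumes "bounded_linear f" shows "(\<Sum>b\<in>Basis. (v \<bullet> b) * f b) = f v"
proof -
  interpret bounded_linear f by fact
  have "f (\<Sum>b\<in>Basis. (v \<bullet> b) *\<^sub>R b) = (\<Sum>b\<in>Basis. (v \<bullet> b) * f b)"
    by (simp add: sum scaleR)
  then show ?thesis by (simp add: euclidean_representation)
qed

lemma Ck_on_frechet_derivative_apply:
  assumes U: "open U" and f: "Ck_on (Suc k) U f" and v: "\<And>b. b \<in> Basis \<Longrightarrow> Ck_on k U (\<lambda>x. v x \<bullet> b)"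
  shows "Ck_on k U (\<lambda>x. frechet_derivative f (at x) (v x))"
proof -
  have eq: "(\<Sum>b\<in>Basis. (v x \<bullet> b) * frechet_derivative f (at x) b) = frechet_derivative f (at x) (v x)"
    if "x \<in> U" for x
    by (rule bounded_linear_eq_sum_Basis[OF has_derivative_bounded_linear[OF
          Ck_on_Suc_has_derivative[OF U f that]]])
  have "Ck_on k U (\<lambda>x. \<Sum>b\<in>Basis. (v x \<bullet> b) * frechet_derivative f (at x) b)"
    by (intro Ck_on_sum Ck_on_mult U v Ck_on_frechet_derivative[OF f])
  then show ?thesis using Ck_on_cong[OF U eq] by simp
qed

lemma Ck_on_tproj_inner:
  assumes U: "open U" shows "Ck_on k U (\<lambda>p. tproj p b \<bullet> b')"
proof -
  have i: "Ck_on k U (\<lambda>p. p \<bullet> b)" for b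
    using Ck_on_inner[OF U, of k b] by (simp only: inner_commute[of _ b])
  have "Ck_on k U (\<lambda>p. b \<bullet> b' - (p \<bullet> b) * (p \<bullet> b'))"
    by (intro Ck_on_diff Ck_on_mult i Ck_on_const U)
  then show ?thesis by (simp add: tproj_def inner_diff_left)
qed

lemma Ck_on_sphere_grad_component:
  assumes "open U" "Ck_on (Suc k) U f"
  shows "Ck_on k U (sphere_grad_component f b)"
  unfolding sphere_grad_component_def[abs_def]
  by (rule Ck_on_frechet_derivative_apply[OF assms Ck_on_tproj_inner[OF assms(1)]])

lemma sphere_grad_has_derivative:
  assumes U: "open U" and f: "Ck_on (Suc (Suc k)) U f" and p: "p \<in> U"
  shows "(sphere_grad f has_derivative
    (\<lambda>h. \<Sum>b\<in>Basis. frechet_derivative (sphere_grad_component f b) (at p) h *\<^sub>R b)) (at p)"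
  unfolding sphere_grad_eq[abs_def]
  by (intro has_derivative_sum has_derivative_scaleR_left
      Ck_on_Suc_has_derivative[OF U Ck_on_sphere_grad_component[OF U f] p])

lemma Ck_on_sphere_laplacian:
  assumes U: "open U" and f: "Ck_on (Suc (Suc k)) U f"
  shows "Ck_on k U (sphere_laplacian f)"
proof -
  let ?g = "\<lambda>b'. sphere_grad_component f b'"
  have eq: "(\<Sum>b\<in>Basis. \<Sum>b'\<in>Basis. frechet_derivative (?g b') (at p) (tproj p b) * (tproj p b' \<bullet> b)) =
      sphere_laplacian f p" if p: "p \<in> U" for p
  proof -
    have "frechet_derivative (sphere_grad f) (at p) =
        (\<lambda>h. \<Sum>b\<in>Basis. frechet_derivative (?g b) (at p) h *\<^sub>R b)"
      using frechet_derivative_at[OF sphere_grad_has_derivative[OF U f p]] by simp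
    moreover have "tproj p (\<Sum>b\<in>Basis. a b *\<^sub>R b) \<bullet> v = (\<Sum>b\<in>Basis. a b * (tproj p b \<bullet> v))"
      for a :: "real^3 \<Rightarrow> real" and v
      by (simp add: tproj_def inner_diff_left inner_sum_left inner_sum_right sum_subtractf
          sum_distrib_right sum_distrib_left algebra_simps)
    ultimately show ?thesis
      by (simp add: sphere_laplacian_def sphere_div_def sphere_conn_def)
  qed
  have "Ck_on k U (\<lambda>p. \<Sum>b\<in>Basis. \<Sum>b'\<in>Basis.
      frechet_derivative (?g b') (at p) (tproj p b) * (tproj p b' \<bullet> b))"
    by (intro Ck_on_sum Ck_on_mult Ck_on_tproj_inner U
        Ck_on_frechet_derivative_apply[OF U Ck_on_sphere_grad_component[OF U f]])
  then show ?thesis using Ck_on_cong[OF U eq] by simp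
qed

lemma sphere_grad_inner:
  assumes f: "(f has_derivative f') (at p)"
  shows "sphere_grad f p \<bullet> v = f' (tproj p v)"
proof -
  interpret bounded_linear f' using f by (rule has_derivative_bounded_linear)
  have "tproj p v = (\<Sum>b\<in>Basis. (b \<bullet> v) *\<^sub>R tproj p b)"
  proof -
    have "(\<Sum>b\<in>Basis. (b \<bullet> v) *\<^sub>R tproj p b) =
        (\<Sum>b\<in>Basis. (v \<bullet> b) *\<^sub>R b) - (\<Sum>b\<in>Basis. ((b \<bullet> p) * (b \<bullet> v)) *\<^sub>R p)"
      by (simp add: tproj_def algebra_simps sum_subtractf inner_commute)
    also have "\<dots> = v - (p \<bullet> v) *\<^sub>R p"
      by (simp add: euclidean_representation inner_eq_sum_Basis[of p v] scaleR_sum_left)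
    finally show ?thesis by (simp add: tproj_def)
  qed
  then have "f' (tproj p v) = (\<Sum>b\<in>Basis. (b \<bullet> v) * f' (tproj p b))"
    by (simp add: sum scaleR)
  then show ?thesis
    using frechet_derivative_at[OF f]
    by (simp add: sphere_grad_def inner_sum_left mult.commute)
qed

section \<open>Geodesic polar coordinates\<close>

locale polar_frame =
  fixes c e1 e2 :: "real^3"
  assumes on: "c \<bullet> c = 1" "e1 \<bullet> e1 = 1" "e2 \<bullet> e2 = 1" "c \<bullet> e1 = 0" "c \<bullet> e2 = 0" "e1 \<bullet> e2 = 0"
begin

lemma on': "e1 \<bullet> c = 0" "e2 \<bullet> c = 0" "e2 \<bullet> e1 = 0"
  using on by (simp_all add: inner_commute)

definition pol :: "real \<Rightarrow> real \<Rightarrow> real^3" where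
  "pol r \<theta> = cos r *\<^sub>R c + (sin r * cos \<theta>) *\<^sub>R e1 + (sin r * sin \<theta>) *\<^sub>R e2"

definition pol_r :: "real \<Rightarrow> real \<Rightarrow> real^3" where
  "pol_r r \<theta> = (- sin r) *\<^sub>R c + (cos r * cos \<theta>) *\<^sub>R e1 + (cos r * sin \<theta>) *\<^sub>R e2"

text \<open>The coordinate vector itself, of length \<open>\<bar>sin r\<bar>\<close>: unlike the
  unit vector it is defined and smooth at the poles.\<close>

definition pol_th :: "real \<Rightarrow> real \<Rightarrow> real^3" where
  "pol_th r \<theta> = (- sin r * sin \<theta>) *\<^sub>R e1 + (sin r * cos \<theta>) *\<^sub>R e2"

lemma pol_inner:
  "pol r \<theta> \<bullet> pol r \<theta> = 1" "pol_r r \<theta> \<bullet> pol_r r \<theta> = 1" "pol_th r \<theta> \<bullet> pol_th r \<theta> = (sin r)\<^sup>2"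
  "pol r \<theta> \<bullet> pol_r r \<theta> = 0" "pol r \<theta> \<bullet> pol_th r \<theta> = 0" "pol_r r \<theta> \<bullet> pol_th r \<theta> = 0"
  "c \<bullet> pol r \<theta> = cos r" "e1 \<bullet> pol r \<theta> = sin r * cos \<theta>" "e2 \<bullet> pol r \<theta> = sin r * sin \<theta>"
proof -
  have s: "sin x * sin x = 1 - cos x * cos x" for x :: real
    using sin_squared_eq[of x] by (simp add: power2_eq_square)
  show "pol r \<theta> \<bullet> pol r \<theta> = 1" "pol_r r \<theta> \<bullet> pol_r r \<theta> = 1" "pol_th r \<theta> \<bullet> pol_th r \<theta> = (sin r)\<^sup>2"
  "pol r \<theta> \<bullet> pol_r r \<theta> = 0" "pol r \<theta> \<bullet> pol_th r \<theta> = 0" "pol_r r \<theta> \<bullet> pol_th r \<theta> = 0"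
  "c \<bullet> pol r \<theta> = cos r" "e1 \<bullet> pol r \<theta> = sin r * cos \<theta>" "e2 \<bullet> pol r \<theta> = sin r * sin \<theta>"
    using s[of r] s[of \<theta>]
    unfolding pol_def pol_r_def pol_th_def power2_eq_square
    by (simp_all add: inner_add_left inner_add_right inner_diff_left inner_diff_right on on') algebra+
qed

text \<open>The last two are accelerations of coordinate curves: meridians are geodesics, with
  purely normal acceleration, while circles of latitude have in addition a tangential part along
  \<open>pol_r\<close>.\<close>

lemma pol_has_derivative:
  "((\<lambda>r. pol r \<theta>) has_vector_derivative pol_r r \<theta>) (at r)"
  "((\<lambda>\<theta>. pol r \<theta>) has_vector_derivative pol_th r \<theta>) (at \<theta>)"
  "((\<lambda>r. pol_r r \<theta>) has_vector_derivative - pol r \<theta>) (at r)"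
  "((\<lambda>\<theta>. pol_th r \<theta>) has_vector_derivative - ((sin r)\<^sup>2 *\<^sub>R pol r \<theta> + (sin r * cos r) *\<^sub>R pol_r r \<theta>)) (at \<theta>)"
proof -
  have a: "(sin r)\<^sup>2 * (sin r * x) + sin r * cos r * (cos r * x) = sin r * x" for x
    using sin_cos_squared_add[of r] by algebra
  have "(sin r)\<^sup>2 *\<^sub>R pol r \<theta> + (sin r * cos r) *\<^sub>R pol_r r \<theta> =
      ((sin r)\<^sup>2 * cos r + sin r * cos r * (- sin r)) *\<^sub>R c +
      ((sin r)\<^sup>2 * (sin r * cos \<theta>) + sin r * cos r * (cos r * cos \<theta>)) *\<^sub>R e1 +
      ((sin r)\<^sup>2 * (sin r * sin \<theta>) + sin r * cos r * (cos r * sin \<theta>)) *\<^sub>R e2"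
    unfolding pol_def pol_r_def
    by (simp only: scaleR_add_right scaleR_scaleR scaleR_add_left add_ac)
  also have "\<dots> = (sin r * cos \<theta>) *\<^sub>R e1 + (sin r * sin \<theta>) *\<^sub>R e2"
    unfolding a by (simp add: power2_eq_square)
  finally have "(sin r)\<^sup>2 *\<^sub>R pol r \<theta> + (sin r * cos r) *\<^sub>R pol_r r \<theta> =
      (sin r * cos \<theta>) *\<^sub>R e1 + (sin r * sin \<theta>) *\<^sub>R e2" .
  then show "((\<lambda>\<theta>. pol_th r \<theta>) has_vector_derivative
      - ((sin r)\<^sup>2 *\<^sub>R pol r \<theta> + (sin r * cos r) *\<^sub>R pol_r r \<theta>)) (at \<theta>)"
    unfolding pol_th_def has_vector_derivative_def
    by (auto intro!: derivative_eq_intros simp: algebra_simps)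
qed (unfold pol_def pol_r_def pol_th_def has_vector_derivative_def,
    (auto intro!: derivative_eq_intros simp: algebra_simps)+)

lemma c_eq: "c = cos r *\<^sub>R pol r \<theta> - sin r *\<^sub>R pol_r r \<theta>"
proof -
  have "cos r *\<^sub>R pol r \<theta> - sin r *\<^sub>R pol_r r \<theta> = ((sin r)\<^sup>2 + (cos r)\<^sup>2) *\<^sub>R c"
    unfolding pol_def pol_r_def power2_eq_square scaleR_add_left by (simp add: algebra_simps del: sin_times_sin cos_times_cos)
  then show ?thesis by simp
qed

lemma disk_normal_pol: "sin r \<noteq> 0 \<Longrightarrow> disk_normal c r (pol r \<theta>) = pol_r r \<theta>"
proof -
  assume "sin r \<noteq> 0"
  moreover have "cos r *\<^sub>R pol r \<theta> - c = sin r *\<^sub>R pol_r r \<theta>"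
    using c_eq[of r \<theta>] by (simp add: algebra_simps)
  ultimately show ?thesis by (simp add: disk_normal_def)
qed

lemma sphere_polar:
  assumes "p \<bullet> p = 1"
  obtains \<theta> where "0 \<le> \<theta>" "\<theta> < 2 * pi" "p = pol (arccos (c \<bullet> p)) \<theta>"
proof -
  define r where "r = arccos (c \<bullet> p)"
  have ex: "p = (c \<bullet> p) *\<^sub>R c + (e1 \<bullet> p) *\<^sub>R e1 + (e2 \<bullet> p) *\<^sub>R e2"
    using orthonormal_expand3[of c e1 e2 p] on by (simp add: inner_commute)
  have "p \<bullet> p = (c \<bullet> p)\<^sup>2 + (e1 \<bullet> p)\<^sup>2 + (e2 \<bullet> p)\<^sup>2"
    by (subst (2) ex) (simp add: inner_add_right power2_eq_square inner_commute)
  then have sq: "(c \<bullet> p)\<^sup>2 + (e1 \<bullet> p)\<^sup>2 + (e2 \<bullet> p)\<^sup>2 = 1" using assms by simp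
  then have "(c \<bullet> p)\<^sup>2 \<le> 1" by (smt (verit) zero_le_power2)
  then have le: "\<bar>c \<bullet> p\<bar> \<le> 1" by (simp add: abs_square_le_1)
  have cr: "cos r = c \<bullet> p" using le by (simp add: r_def cos_arccos_abs)
  have "sin r = sqrt (1 - (c \<bullet> p)\<^sup>2)" using le by (simp add: r_def sin_arccos_abs)
  then have "sin r = sqrt ((e1 \<bullet> p)\<^sup>2 + (e2 \<bullet> p)\<^sup>2)" using sq by (simp add: algebra_simps)
  then have sr: "(sin r)\<^sup>2 = (e1 \<bullet> p)\<^sup>2 + (e2 \<bullet> p)\<^sup>2" by simp
  show thesis
  proof (cases "sin r = 0")
    case True
    then have "e1 \<bullet> p = 0" "e2 \<bullet> p = 0" using sr by (auto simp: sum_power2_eq_zero_iff)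
    then have "p = pol r 0" using ex cr True by (simp add: pol_def)
    then show thesis using that[of 0] by (simp add: r_def)
  next
    case False
    have "(e1 \<bullet> p / sin r)\<^sup>2 + (e2 \<bullet> p / sin r)\<^sup>2 = 1"
      unfolding power_divide add_divide_distrib[symmetric] sr[symmetric] using False by simp
    then obtain \<theta> where \<theta>: "0 \<le> \<theta>" "\<theta> < 2 * pi" "e1 \<bullet> p / sin r = cos \<theta>" "e2 \<bullet> p / sin r = sin \<theta>"
      using sincos_total_2pi by metis
    then have "e1 \<bullet> p = sin r * cos \<theta>" "e2 \<bullet> p = sin r * sin \<theta>" using False by (auto simp: field_simps)
    then have "p = pol r \<theta>" using ex cr by (simp add: pol_def)
    then show thesis using that \<theta> by (simp add: r_def)
  qed
qed

end

lemma polar_frame_exists: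
  fixes c :: "real^3"
  assumes "norm c = 1"
  obtains e1 e2 where "polar_frame c e1 e2"
proof -
  obtain S where S: "c \<in> S" "pairwise orthogonal S" "\<And>x. x \<in> S \<Longrightarrow> norm x = 1"
    "card S = DIM(real^3)"
    using vector_in_orthonormal_basis[OF assms] by metis
  have fin: "finite S" using S(4) card.infinite by fastforce
  have "card (S - {c}) = 2" using S(1,4) fin by simp
  then obtain e1 e2 where e: "S - {c} = {e1, e2}" "e1 \<noteq> e2" by (auto simp: card_2_iff)
  then have "e1 \<in> S" "e2 \<in> S" "e1 \<noteq> c" "e2 \<noteq> c" by auto
  then have "polar_frame c e1 e2"
    using S(1-3) e(2) unfolding polar_frame_def pairwise_def orthogonal_def by (metis norm_eq_1)
  then show thesis by (rule that)
qed

context polar_frame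
begin

definition f_r :: "(real^3 \<Rightarrow> real) \<Rightarrow> real \<Rightarrow> real \<Rightarrow> real" where
  "f_r f r \<theta> = frechet_derivative f (at (pol r \<theta>)) (pol_r r \<theta>)"

definition f_th :: "(real^3 \<Rightarrow> real) \<Rightarrow> real \<Rightarrow> real \<Rightarrow> real" where
  "f_th f r \<theta> = frechet_derivative f (at (pol r \<theta>)) (pol_th r \<theta>)"

text \<open>Stated through the derivative of the gradient, because this is the summand that occurs
  in the trace; \<open>polar_deriv2\<close> shows that it is the second derivative in
  \<open>r\<close>.\<close>

definition f_rr :: "(real^3 \<Rightarrow> real) \<Rightarrow> real \<Rightarrow> real \<Rightarrow> real" where
  "f_rr f r \<theta> = (\<Sum>b\<in>Basis. frechet_derivative (sphere_grad_component f b) (at (pol r \<theta>)) (pol_r r \<theta>) *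
     (pol_r r \<theta> \<bullet> b))"

text \<open>The subtracted term pairs the gradient with the tangential acceleration of the circle of
  latitude; it makes the whole the second derivative in \<open>\<theta>\<close>.\<close>

definition f_thth :: "(real^3 \<Rightarrow> real) \<Rightarrow> real \<Rightarrow> real \<Rightarrow> real" where
  "f_thth f r \<theta> = (\<Sum>b\<in>Basis. frechet_derivative (sphere_grad_component f b) (at (pol r \<theta>)) (pol_th r \<theta>) *
     (pol_th r \<theta> \<bullet> b)) - sin r * cos r * f_r f r \<theta>"

lemma has_real_derivative_along:
  assumes "(\<gamma> has_vector_derivative v) (at t)" "(f has_derivative f') (at (\<gamma> t))"
  shows "((\<lambda>s. f (\<gamma> s)) has_real_derivative f' v) (at t)"
proof -
  interpret bounded_linear f' using assms(2) by (rule has_derivative_bounded_linear)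
  show ?thesis
    using has_derivative_compose[OF assms(1)[unfolded has_vector_derivative_def] assms(2)]
    by (simp add: has_field_derivative_def scaleR mult_commute_abs)
qed

context
  fixes U :: "(real^3) set" and f :: "real^3 \<Rightarrow> real" and r \<theta> :: real
  assumes U: "open U" and f: "Ck_on (Suc (Suc 0)) U f" and p: "pol r \<theta> \<in> U"
begin

lemma f_has_derivative: "(f has_derivative frechet_derivative f (at (pol r \<theta>))) (at (pol r \<theta>))"
  by (rule Ck_on_Suc_has_derivative[OF U f p])

lemma polar_deriv:
  "((\<lambda>r. f (pol r \<theta>)) has_real_derivative f_r f r \<theta>) (at r)"
  "((\<lambda>\<theta>. f (pol r \<theta>)) has_real_derivative f_th f r \<theta>) (at \<theta>)"
  unfolding f_r_def f_th_def
  using has_real_derivative_along[OF pol_has_derivative(1) f_has_derivative]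
    has_real_derivative_along[OF pol_has_derivative(2) f_has_derivative] .

lemma grad_pol:
  "sphere_grad f (pol r \<theta>) \<bullet> pol_r r \<theta> = f_r f r \<theta>"
  "sphere_grad f (pol r \<theta>) \<bullet> pol_th r \<theta> = f_th f r \<theta>"
  "sphere_grad f (pol r \<theta>) \<bullet> pol r \<theta> = 0"
proof -
  interpret bounded_linear "frechet_derivative f (at (pol r \<theta>))"
    using f_has_derivative by (rule has_derivative_bounded_linear)
  show "sphere_grad f (pol r \<theta>) \<bullet> pol_r r \<theta> = f_r f r \<theta>"
    "sphere_grad f (pol r \<theta>) \<bullet> pol_th r \<theta> = f_th f r \<theta>"
    "sphere_grad f (pol r \<theta>) \<bullet> pol r \<theta> = 0"
    unfolding sphere_grad_inner[OF f_has_derivative]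
    by (simp_all add: tproj_def pol_inner f_r_def f_th_def zero)
qed

end

text \<open>Differentiating the inner product of the gradient with \<open>pol_r\<close> or
  \<open>pol_th\<close> along a coordinate curve gives a term of the trace plus the gradient paired
  with the acceleration; the normal part drops out since the gradient is tangent. The factor
  \<open>(sin r)\<^sup>2\<close> lets the last identity include the poles.\<close>

lemma polar_deriv2:
  fixes U :: "(real^3) set" and f :: "real^3 \<Rightarrow> real" and r \<theta> :: real
  assumes U: "open U" and f: "Ck_on (Suc (Suc 0)) U f" and p: "pol r \<theta> \<in> U"
  shows "((\<lambda>r. f_r f r \<theta>) has_real_derivative f_rr f r \<theta>) (at r)"
    and "((\<lambda>\<theta>. f_th f r \<theta>) has_real_derivative f_thth f r \<theta>) (at \<theta>)"
    and "(sin r)\<^sup>2 * sphere_laplacian f (pol r \<theta>) =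
      (sin r)\<^sup>2 * f_rr f r \<theta> + sin r * cos r * f_r f r \<theta> + f_thth f r \<theta>"
proof -
  define X' where "X' = (\<lambda>h. \<Sum>b\<in>Basis. frechet_derivative (sphere_grad_component f b) (at (pol r \<theta>)) h *\<^sub>R b)"
  have X: "(sphere_grad f has_derivative X') (at (pol r \<theta>))"
    unfolding X'_def by (rule sphere_grad_has_derivative[OF U f p])
  interpret X': bounded_linear X' using X by (rule has_derivative_bounded_linear)
  have X'i: "X' h \<bullet> v = (\<Sum>b\<in>Basis. frechet_derivative (sphere_grad_component f b) (at (pol r \<theta>)) h * (v \<bullet> b))" for h v
    unfolding X'_def inner_sum_left by (simp add: inner_commute)
  have cont: "continuous_on UNIV (\<lambda>r. pol r \<theta>)" "continuous_on UNIV (\<lambda>\<theta>. pol r \<theta>)"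
    unfolding pol_def by (intro continuous_intros)+
  have op: "open ((\<lambda>r. pol r \<theta>) -` U)" "open ((\<lambda>\<theta>. pol r \<theta>) -` U)"
    using open_vimage[OF U] cont by auto
  have along: "((\<lambda>s. sphere_grad f (\<gamma> s) \<bullet> w s) has_real_derivative
      X' v \<bullet> w t + sphere_grad f (\<gamma> t) \<bullet> w') (at t)"
    if "(\<gamma> has_vector_derivative v) (at t)" "(w has_vector_derivative w') (at t)" "\<gamma> t = pol r \<theta>" for \<gamma> w v w' t
  proof -
    have "((\<lambda>s. sphere_grad f (\<gamma> s)) has_derivative (\<lambda>h. h *\<^sub>R X' v)) (at t)"
      using has_derivative_compose[OF that(1)[unfolded has_vector_derivative_def], of "sphere_grad f" X'] X that(3)
      by (simp add: X'.scaleR)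
    from has_derivative_inner[OF this that(2)[unfolded has_vector_derivative_def]]
    show ?thesis unfolding has_field_derivative_def
      by (rule has_derivative_eq_rhs) (simp add: fun_eq_iff algebra_simps)
  qed
  have "((\<lambda>r. sphere_grad f (pol r \<theta>) \<bullet> pol_r r \<theta>) has_real_derivative f_rr f r \<theta>) (at r)"
    using along[OF pol_has_derivative(1)[of \<theta> r] pol_has_derivative(3)[of \<theta> r] refl] grad_pol[OF U f p]
    by (simp add: f_rr_def X'i)
  \<comment> \<open>\<open>f_r\<close> is identified with the inner product only where the point
    lies in \<open>U\<close>, which holds on a neighbourhood of \<open>r\<close>.\<close>
  then show "((\<lambda>r. f_r f r \<theta>) has_real_derivative f_rr f r \<theta>) (at r)"
    by (rule has_field_derivative_transform_within_open[OF _ op(1)])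
      (use p grad_pol[OF U f] in auto)
  have "((\<lambda>\<theta>. sphere_grad f (pol r \<theta>) \<bullet> pol_th r \<theta>) has_real_derivative f_thth f r \<theta>) (at \<theta>)"
    using along[OF pol_has_derivative(2)[of r \<theta>] pol_has_derivative(4)[of r \<theta>] refl] grad_pol[OF U f p]
    by (simp add: f_thth_def X'i inner_add_right inner_diff_right)
  then show "((\<lambda>\<theta>. f_th f r \<theta>) has_real_derivative f_thth f r \<theta>) (at \<theta>)"
    by (rule has_field_derivative_transform_within_open[OF _ op(2)])
      (use p grad_pol[OF U f] in auto)
  show "(sin r)\<^sup>2 * sphere_laplacian f (pol r \<theta>) =
      (sin r)\<^sup>2 * f_rr f r \<theta> + sin r * cos r * f_r f r \<theta> + f_thth f r \<theta>"
  proof (cases "sin r = 0")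
    case True
    then have "pol_th r \<theta> = 0" by (simp add: pol_th_def)
    then show ?thesis using True by (simp add: f_thth_def)
  next
    case False
    define e where "e = (1 / sin r) *\<^sub>R pol_th r \<theta>"
    have "e \<bullet> e = 1" "pol r \<theta> \<bullet> e = 0" "pol_r r \<theta> \<bullet> e = 0"
      using False by (simp_all add: e_def pol_inner power2_eq_square)
    then have "sphere_laplacian f (pol r \<theta>) = X' (pol_r r \<theta>) \<bullet> pol_r r \<theta> + X' e \<bullet> e"
      unfolding sphere_laplacian_def by (intro sphere_div_orthonormal X pol_inner)
    moreover have "X' (pol_r r \<theta>) \<bullet> pol_r r \<theta> = f_rr f r \<theta>"
      by (simp add: X'i f_rr_def)
    moreover have "(sin r)\<^sup>2 * (X' e \<bullet> e) = X' (pol_th r \<theta>) \<bullet> pol_th r \<theta>"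
      using False by (simp add: e_def X'.scaleR power2_eq_square)
    moreover have "X' (pol_th r \<theta>) \<bullet> pol_th r \<theta> = f_thth f r \<theta> + sin r * cos r * f_r f r \<theta>"
      by (simp add: X'i f_thth_def)
    ultimately show ?thesis by (simp add: algebra_simps)
  qed
qed

lemma continuous_on_pol: "continuous_on S (\<lambda>x. pol (fst x) (snd x))"
  "continuous_on S (\<lambda>x. pol_r (fst x) (snd x))" "continuous_on S (\<lambda>x. pol_th (fst x) (snd x))"
  unfolding pol_def pol_r_def pol_th_def by (intro continuous_intros)+

lemma continuous_on_frechet_derivative_apply:
  fixes f :: "real^3 \<Rightarrow> real"
  assumes U: "open U" and f: "Ck_on (Suc 0) U f" and \<gamma>: "continuous_on S \<gamma>" "\<gamma> ` S \<subseteq> U" and v: "continuous_on S v"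
  shows "continuous_on S (\<lambda>x. frechet_derivative f (at (\<gamma> x)) (v x))"
proof -
  have eq: "(\<Sum>b\<in>Basis. (v x \<bullet> b) * frechet_derivative f (at (\<gamma> x)) b) = frechet_derivative f (at (\<gamma> x)) (v x)"
    if "x \<in> S" for x
    by (rule bounded_linear_eq_sum_Basis[OF has_derivative_bounded_linear[OF
          Ck_on_Suc_has_derivative[OF U f]]])
      (use \<gamma>(2) that in auto)
  have "continuous_on S (\<lambda>x. frechet_derivative f (at (\<gamma> x)) b)" if "b \<in> Basis" for b
    using continuous_on_compose2[OF Ck_on_continuous[OF Ck_on_frechet_derivative[OF f that]] \<gamma>] .
  then have "continuous_on S (\<lambda>x. \<Sum>b\<in>Basis. (v x \<bullet> b) * frechet_derivative f (at (\<gamma> x)) b)"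
    by (intro continuous_intros v) auto
  then show ?thesis by (rule continuous_on_eq) (rule eq)
qed

lemma continuous_on_polar:
  assumes U: "open U" and f: "Ck_on (Suc (Suc 0)) U f"
    and S: "\<And>x. x \<in> S \<Longrightarrow> pol (fst x) (snd x) \<in> U"
  shows "continuous_on S (\<lambda>x. f (pol (fst x) (snd x)))"
    "continuous_on S (\<lambda>x. f_r f (fst x) (snd x))"
    "continuous_on S (\<lambda>x. f_th f (fst x) (snd x))"
    "continuous_on S (\<lambda>x. f_rr f (fst x) (snd x))"
    "continuous_on S (\<lambda>x. f_thth f (fst x) (snd x))"
proof -
  have im: "(\<lambda>x. pol (fst x) (snd x)) ` S \<subseteq> U" using S by auto
  note f1 = Ck_on_SucD[OF U f]
  show "continuous_on S (\<lambda>x. f (pol (fst x) (snd x)))"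
    using continuous_on_compose2[OF Ck_on_continuous[OF f] continuous_on_pol(1) im] .
  show fr: "continuous_on S (\<lambda>x. f_r f (fst x) (snd x))" "continuous_on S (\<lambda>x. f_th f (fst x) (snd x))"
    unfolding f_r_def f_th_def
    by (intro continuous_on_frechet_derivative_apply[OF U f1 _ im] continuous_on_pol)+
  show "continuous_on S (\<lambda>x. f_rr f (fst x) (snd x))" "continuous_on S (\<lambda>x. f_thth f (fst x) (snd x))"
    unfolding f_rr_def f_thth_def
    by (intro continuous_intros fr continuous_on_pol
        continuous_on_frechet_derivative_apply[OF U Ck_on_sphere_grad_component[OF U f] _ im])+
qed

text \<open>For a product \<open>a r * \<phi> \<theta>\<close> every polar derivative is determined
  by uniqueness of real derivatives, so the Laplacian is found without differentiating the ambient
  expression for \<open>f\<close>.\<close>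

lemma polar_laplacianI:
  assumes U: "open U" and f: "Ck_on (Suc (Suc 0)) U f" and S: "open S"
    and in_U: "\<And>r \<theta>. r \<in> S \<Longrightarrow> pol r \<theta> \<in> U"
    and eq: "\<And>r \<theta>. r \<in> S \<Longrightarrow> f (pol r \<theta>) = a r * \<phi> \<theta>"
    and a: "\<And>r. r \<in> S \<Longrightarrow> (a has_real_derivative a' r) (at r)"
      "\<And>r. r \<in> S \<Longrightarrow> (a' has_real_derivative a'' r) (at r)"
    and \<phi>: "\<And>\<theta>. (\<phi> has_real_derivative \<phi>' \<theta>) (at \<theta>)" "\<And>\<theta>. (\<phi>' has_real_derivative \<phi>'' \<theta>) (at \<theta>)"
    and r: "r \<in> S"
  shows "f_r f r \<theta> = a' r * \<phi> \<theta>"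
    and "(sin r)\<^sup>2 * sphere_laplacian f (pol r \<theta>) =
      ((sin r)\<^sup>2 * a'' r + sin r * cos r * a' r) * \<phi> \<theta> + a r * \<phi>'' \<theta>"
proof -
  have 1: "f_r f r \<theta> = a' r * \<phi> \<theta>" if r: "r \<in> S" for r \<theta>
  proof (rule DERIV_unique)
    show "((\<lambda>r. f (pol r \<theta>)) has_real_derivative f_r f r \<theta>) (at r)"
      by (rule polar_deriv[OF U f in_U[OF r]])
    show "((\<lambda>r. f (pol r \<theta>)) has_real_derivative a' r * \<phi> \<theta>) (at r)"
      by (rule has_field_derivative_transform_within_open[OF _ S r, of "\<lambda>r. a r * \<phi> \<theta>"])
        (auto intro!: derivative_eq_intros a r simp: eq)
  qed
  have 2: "f_th f r \<theta> = a r * \<phi>' \<theta>" for \<theta>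
  proof (rule DERIV_unique)
    show "((\<lambda>\<theta>. f (pol r \<theta>)) has_real_derivative f_th f r \<theta>) (at \<theta>)"
      by (rule polar_deriv[OF U f in_U[OF r]])
    show "((\<lambda>\<theta>. f (pol r \<theta>)) has_real_derivative a r * \<phi>' \<theta>) (at \<theta>)"
      unfolding eq[OF r] by (auto intro!: derivative_eq_intros \<phi>)
  qed
  have 3: "f_rr f r \<theta> = a'' r * \<phi> \<theta>"
  proof (rule DERIV_unique)
    show "((\<lambda>r. f_r f r \<theta>) has_real_derivative f_rr f r \<theta>) (at r)"
      by (rule polar_deriv2[OF U f in_U[OF r]])
    show "((\<lambda>r. f_r f r \<theta>) has_real_derivative a'' r * \<phi> \<theta>) (at r)"
      by (rule has_field_derivative_transform_within_open[OF _ S r, of "\<lambda>r. a' r * \<phi> \<theta>"])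
        (auto intro!: derivative_eq_intros a r simp: 1)
  qed
  have 4: "f_thth f r \<theta> = a r * \<phi>'' \<theta>"
  proof (rule DERIV_unique)
    show "((\<lambda>\<theta>. f_th f r \<theta>) has_real_derivative f_thth f r \<theta>) (at \<theta>)"
      by (rule polar_deriv2[OF U f in_U[OF r]])
    show "((\<lambda>\<theta>. f_th f r \<theta>) has_real_derivative a r * \<phi>'' \<theta>) (at \<theta>)"
      unfolding 2 by (auto intro!: derivative_eq_intros \<phi>)
  qed
  show "f_r f r \<theta> = a' r * \<phi> \<theta>" by (rule 1[OF r])
  show "(sin r)\<^sup>2 * sphere_laplacian f (pol r \<theta>) =
      ((sin r)\<^sup>2 * a'' r + sin r * cos r * a' r) * \<phi> \<theta> + a r * \<phi>'' \<theta>"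
    unfolding polar_deriv2(3)[OF U f in_U[OF r]] 1[OF r] 3 4 by (simp add: algebra_simps)
qed

end

section \<open>Fourier modes\<close>

inductive trig_poly :: "(real \<Rightarrow> real) \<Rightarrow> bool" where
  cos: "trig_poly (\<lambda>\<theta>. cos (real n * \<theta>))"
| sin: "trig_poly (\<lambda>\<theta>. sin (real n * \<theta>))"
| scale: "trig_poly f \<Longrightarrow> trig_poly (\<lambda>\<theta>. a * f \<theta>)"
| add: "trig_poly f \<Longrightarrow> trig_poly g \<Longrightarrow> trig_poly (\<lambda>\<theta>. f \<theta> + g \<theta>)"

lemma trig_poly_cos_int: "trig_poly (\<lambda>\<theta>. cos (of_int k * \<theta>))"
proof (cases "k \<ge> 0")
  case True
  then show ?thesis using trig_poly.cos[of "nat k"] by simp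
next
  case False
  have "trig_poly (\<lambda>\<theta>. cos (real (nat (- k)) * \<theta>))" by (rule trig_poly.cos)
  then show ?thesis using False by simp
qed

lemma trig_poly_sin_int: "trig_poly (\<lambda>\<theta>. sin (of_int k * \<theta>))"
proof (cases "k \<ge> 0")
  case True
  then show ?thesis using trig_poly.sin[of "nat k"] by simp
next
  case False
  have "trig_poly (\<lambda>\<theta>. (- 1) * sin (real (nat (- k)) * \<theta>))" by (intro trig_poly.scale trig_poly.sin)
  then show ?thesis using False by simp
qed

text \<open>Product-to-sum formulas; the difference of two frequencies may be negative, which calls
  for the versions with integer frequency.\<close>

lemma trig_poly_mult_basic:
  assumes "trig_poly g"
  shows "trig_poly (\<lambda>\<theta>. cos (real n * \<theta>) * g \<theta>)" "trig_poly (\<lambda>\<theta>. sin (real n * \<theta>) * g \<theta>)"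
  using assms
proof induction
  case (cos m)
  have "trig_poly (\<lambda>\<theta>. 1/2 * cos (of_int (int n - int m) * \<theta>) + 1/2 * cos (of_int (int n + int m) * \<theta>))"
    "trig_poly (\<lambda>\<theta>. 1/2 * sin (of_int (int n + int m) * \<theta>) + 1/2 * sin (of_int (int n - int m) * \<theta>))"
    by (intro trig_poly.scale trig_poly.add trig_poly_cos_int trig_poly_sin_int)+
  then show "trig_poly (\<lambda>\<theta>. cos (real n * \<theta>) * cos (real m * \<theta>))"
    "trig_poly (\<lambda>\<theta>. sin (real n * \<theta>) * cos (real m * \<theta>))"
    by (simp_all add: ring_distribs cos_add cos_diff sin_add sin_diff mult.commute)
next
  case (sin m)
  have "trig_poly (\<lambda>\<theta>. 1/2 * cos (of_int (int n - int m) * \<theta>) + (- 1/2) * cos (of_int (int n + int m) * \<theta>))"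
    "trig_poly (\<lambda>\<theta>. 1/2 * sin (of_int (int n + int m) * \<theta>) + (- 1/2) * sin (of_int (int n - int m) * \<theta>))"
    by (intro trig_poly.scale trig_poly.add trig_poly_cos_int trig_poly_sin_int)+
  then show "trig_poly (\<lambda>\<theta>. cos (real n * \<theta>) * sin (real m * \<theta>))"
    "trig_poly (\<lambda>\<theta>. sin (real n * \<theta>) * sin (real m * \<theta>))"
    by (simp_all add: ring_distribs cos_add cos_diff sin_add sin_diff mult.commute)
next
  case (scale f a)
  show "trig_poly (\<lambda>\<theta>. cos (real n * \<theta>) * (a * f \<theta>))" "trig_poly (\<lambda>\<theta>. sin (real n * \<theta>) * (a * f \<theta>))"
    using scale.IH[THEN trig_poly.scale[of _ a]] by (simp_all add: mult.left_commute)
next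
  case (add f g)
  then show "trig_poly (\<lambda>\<theta>. cos (real n * \<theta>) * (f \<theta> + g \<theta>))" "trig_poly (\<lambda>\<theta>. sin (real n * \<theta>) * (f \<theta> + g \<theta>))"
    using add.IH(1,3)[THEN trig_poly.add] add.IH(2,4)[THEN trig_poly.add] by (simp_all add: ring_distribs trig_poly.add)
qed

lemma trig_poly_mult: "trig_poly f \<Longrightarrow> trig_poly g \<Longrightarrow> trig_poly (\<lambda>\<theta>. f \<theta> * g \<theta>)"
proof (induction rule: trig_poly.induct)
  case (scale f a)
  then show ?case using trig_poly.scale[of "\<lambda>\<theta>. f \<theta> * g \<theta>" a] by (simp add: mult.assoc)
next
  case (add f h)
  then show ?case using trig_poly.add[of "\<lambda>\<theta>. f \<theta> * g \<theta>" "\<lambda>\<theta>. h \<theta> * g \<theta>"] by (simp add: ring_distribs)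
qed (auto intro: trig_poly_mult_basic)

text \<open>On the unit circle the coordinate functions are cos and sin, so the approximants of
  Stone-Weierstrass become trigonometric polynomials.\<close>

lemma trig_poly_polynomial:
  fixes p :: "complex \<Rightarrow> real"
  assumes "real_polynomial_function p" shows "trig_poly (\<lambda>\<theta>. p (cis \<theta>))"
  using assms
proof induction
  case (linear f)
  interpret bounded_linear f by fact
  have cis: "cis \<theta> = cos \<theta> *\<^sub>R 1 + sin \<theta> *\<^sub>R \<i>" for \<theta>
    by (simp add: complex_eq_iff)
  have "f (cis \<theta>) = f 1 * cos (real 1 * \<theta>) + f \<i> * sin (real 1 * \<theta>)" for \<theta>
    unfolding cis add scaleR by simp
  moreover have "trig_poly (\<lambda>\<theta>. f 1 * cos (real 1 * \<theta>) + f \<i> * sin (real 1 * \<theta>))"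
    by (intro trig_poly.intros)
  ultimately show ?case by simp
next
  case (const c)
  \<comment> \<open>Frequency 0 supplies the constants.\<close>
  show ?case using trig_poly.scale[OF trig_poly.cos[of 0], of c] by simp
qed (auto intro: trig_poly.add trig_poly_mult)

lemma trig_poly_continuous: "trig_poly g \<Longrightarrow> continuous_on S g"
  by (induction rule: trig_poly.induct) (auto intro!: continuous_intros)

text \<open>\<open>f\<close> is orthogonal to every trigonometric polynomial \<open>p\<close>, so
  the integral of \<open>f * f\<close> is that of \<open>f * (f - p)\<close>, hence at most
  \<open>e\<close> times the integral of \<open>\<bar>f\<bar>\<close>. Taking \<open>G\<close> on
  the circle builds in the periodicity that uniform approximation requires.\<close>

lemma trig_complete:
  fixes G :: "complex \<Rightarrow> real"
  assumes G: "continuous_on (sphere 0 1) G"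
    and c: "\<And>n. integral {0..2*pi} (\<lambda>\<theta>. G (cis \<theta>) * cos (real n * \<theta>)) = 0"
    and s: "\<And>n. integral {0..2*pi} (\<lambda>\<theta>. G (cis \<theta>) * sin (real n * \<theta>)) = 0"
    and z: "norm z = 1"
  shows "G z = 0"
proof -
  define f where "f = (\<lambda>\<theta>. G (cis \<theta>))"
  have f: "continuous_on S f" for S
    unfolding f_def by (rule continuous_on_compose2[OF G]) (auto intro!: continuous_intros)
  have orth: "integral {0..2*pi} (\<lambda>\<theta>. f \<theta> * g \<theta>) = 0" if "trig_poly g" for g
    using that
  proof induction
    case (scale g a)
    then show ?case by (simp add: mult.left_commute[of _ a])
  next
    case (add g h)
    have "(\<lambda>\<theta>. f \<theta> * g \<theta>) integrable_on {0..2*pi}" "(\<lambda>\<theta>. f \<theta> * h \<theta>) integrable_on {0..2*pi}"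
      by (intro integrable_continuous_interval continuous_intros f trig_poly_continuous add.hyps)+
    then show ?case using add.IH by (simp add: ring_distribs integral_add)
  qed (use c s f_def in auto)
  have int: "(\<lambda>\<theta>. f \<theta> * f \<theta>) integrable_on {0..2*pi}" "(\<lambda>\<theta>. \<bar>f \<theta>\<bar>) integrable_on {0..2*pi}"
    by (intro integrable_continuous_interval continuous_intros f)+
  have le: "integral {0..2*pi} (\<lambda>\<theta>. f \<theta> * f \<theta>) \<le> e * integral {0..2*pi} (\<lambda>\<theta>. \<bar>f \<theta>\<bar>)" if "e > 0" for e
  proof -
    obtain p where p: "real_polynomial_function p" "\<And>x. x \<in> sphere 0 1 \<Longrightarrow> \<bar>G x - p x\<bar> < e"
      using Stone_Weierstrass_real_polynomial_function[OF compact_sphere G \<open>e > 0\<close>] by metis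
    let ?p = "\<lambda>\<theta>. p (cis \<theta>)"
    have tp: "trig_poly ?p" by (rule trig_poly_polynomial[OF p(1)])
    have i: "(\<lambda>\<theta>. f \<theta> * (f \<theta> - ?p \<theta>)) integrable_on {0..2*pi}" "(\<lambda>\<theta>. f \<theta> * ?p \<theta>) integrable_on {0..2*pi}"
      by (intro integrable_continuous_interval continuous_intros f trig_poly_continuous[OF tp])+
    have "integral {0..2*pi} (\<lambda>\<theta>. f \<theta> * f \<theta>) = integral {0..2*pi} (\<lambda>\<theta>. f \<theta> * (f \<theta> - ?p \<theta>) + f \<theta> * ?p \<theta>)"
      by (simp add: algebra_simps)
    also have "\<dots> = integral {0..2*pi} (\<lambda>\<theta>. f \<theta> * (f \<theta> - ?p \<theta>))"
      using integral_add[OF i] orth[OF tp] by simp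
    also have "\<dots> \<le> integral {0..2*pi} (\<lambda>\<theta>. e * \<bar>f \<theta>\<bar>)"
    proof (rule integral_le[OF i(1)])
      show "(\<lambda>\<theta>. e * \<bar>f \<theta>\<bar>) integrable_on {0..2*pi}" using int(2) by (rule integrable_on_mult_right)
      fix \<theta> :: real
      have "\<bar>f \<theta> - ?p \<theta>\<bar> \<le> e" using p(2)[of "cis \<theta>"] by (simp add: f_def)
      then have "\<bar>f \<theta>\<bar> * \<bar>f \<theta> - ?p \<theta>\<bar> \<le> \<bar>f \<theta>\<bar> * e" by (intro mult_left_mono) auto
      moreover have "f \<theta> * (f \<theta> - ?p \<theta>) \<le> \<bar>f \<theta>\<bar> * \<bar>f \<theta> - ?p \<theta>\<bar>" by (metis abs_ge_self abs_mult)
      ultimately show "f \<theta> * (f \<theta> - ?p \<theta>) \<le> e * \<bar>f \<theta>\<bar>" by (simp add: mult.commute)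
    qed
    finally show ?thesis by simp
  qed
  have nn: "integral {0..2*pi} (\<lambda>\<theta>. \<bar>f \<theta>\<bar>) \<ge> 0" by (rule integral_nonneg[OF int(2)]) simp
  have "integral {0..2*pi} (\<lambda>\<theta>. f \<theta> * f \<theta>) \<le> 0"
  proof (rule field_le_epsilon)
    fix d :: real assume "d > 0"
    define I where "I = integral {0..2*pi} (\<lambda>\<theta>. \<bar>f \<theta>\<bar>)"
    have I: "I \<ge> 0" using nn unfolding I_def .
    \<comment> \<open>With \<open>I + 1\<close> in place of \<open>I\<close> the choice
      \<open>e = d / (I + 1)\<close> is legitimate also when \<open>I = 0\<close>.\<close>
    have "d * I \<le> d * (I + 1)" using \<open>d > 0\<close> by simp
    then have "d / (I + 1) * I \<le> d" using I by (simp add: divide_le_eq)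
    moreover have "d / (I + 1) > 0" using I \<open>d > 0\<close> by simp
    ultimately show "integral {0..2*pi} (\<lambda>\<theta>. f \<theta> * f \<theta>) \<le> 0 + d"
      using le[of "d / (I + 1)"] unfolding I_def[symmetric] by linarith
  qed
  moreover have "integral {0..2*pi} (\<lambda>\<theta>. f \<theta> * f \<theta>) \<ge> 0" by (rule integral_nonneg[OF int(1)]) simp
  ultimately have "((\<lambda>\<theta>. f \<theta> * f \<theta>) has_integral 0) (cbox 0 (2*pi))"
    using int(1) by (simp add: has_integral_integrable_integral)
  then have zero: "f \<theta> * f \<theta> = 0" if "0 \<le> \<theta>" "\<theta> \<le> 2*pi" for \<theta>
    using that pi_gt_zero by (intro has_integral_0_cbox_imp_0[of 0 "2*pi" "\<lambda>\<theta>. f \<theta> * f \<theta>" \<theta>])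
      (auto intro!: continuous_intros f simp: box_ne_empty simp del: pi_gt_zero)
  have "(Re z)\<^sup>2 + (Im z)\<^sup>2 = 1" using z by (simp add: cmod_def)
  then obtain t where "0 \<le> t" "t < 2 * pi" "Re z = cos t" "Im z = sin t"
    using sincos_total_2pi by metis
  moreover from this have "z = cis t" by (simp add: complex_eq_iff)
  ultimately show ?thesis using zero[of t] by (simp add: f_def)
qed

text \<open>\<open>tan (r / 2)\<close> is exp s for s = log tan(r/2), so \<open>sin r\<close> times
  the derivative of its power is \<open>m\<close> times that power.\<close>

lemma tan_half_has_derivative:
  assumes "0 < r" "r < pi"
  shows "((\<lambda>r. tan (r / 2) ^ m) has_real_derivative m * tan (r / 2) ^ m / sin r) (at r)"
proof -
  have pos: "cos (r / 2) > 0" "sin (r / 2) > 0" using assms by (auto intro: cos_gt_zero sin_gt_zero)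
  have s: "sin r = 2 * sin (r / 2) * cos (r / 2)" using sin_double[of "r/2"] by simp
  show ?thesis
  proof (cases m)
    case (Suc n)
    have "((\<lambda>r. tan (r / 2)) has_real_derivative (inverse (cos (r/2)))\<^sup>2 * (1 / 2)) (at r)"
      using pos by (auto intro!: derivative_eq_intros simp: power_inverse)
    moreover have "(inverse (cos (r/2)))\<^sup>2 * (1 / 2) = tan (r / 2) / sin r"
      unfolding s tan_def using pos by (simp add: field_simps power2_eq_square)
    ultimately have "((\<lambda>r. tan (r / 2)) has_real_derivative tan (r / 2) / sin r) (at r)" by simp
    from DERIV_power[OF this, of m] show ?thesis
      by (rule DERIV_cong) (simp add: Suc)
  qed simp
qed

text \<open>
  The quantity \<open>tan (r/2)^m (s - m y)\<close> is constant and vanishes at the pole, which excludes the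
  singular solution; there is thus a single regular solution up to scaling.
\<close>

lemma radial_ode_unique:
  fixes y s :: "real \<Rightarrow> real"
  assumes R: "0 < R" "R < pi"
    and cont: "continuous_on {0..R} y" "continuous_on {0..R} s" and s0: "s 0 = 0"
    and dy: "\<And>r. 0 < r \<Longrightarrow> r < R \<Longrightarrow> (y has_real_derivative s r / sin r) (at r)"
    and ds: "\<And>r. 0 < r \<Longrightarrow> r < R \<Longrightarrow> (s has_real_derivative (real m)\<^sup>2 * y r / sin r) (at r)"
  obtains C where "\<And>r. 0 < r \<Longrightarrow> r \<le> R \<Longrightarrow> y r = C * tan (r / 2) ^ m"
    "\<And>r. 0 < r \<Longrightarrow> r \<le> R \<Longrightarrow> s r = m * y r"
proof -
  have tan_cont: "continuous_on {0..R} (\<lambda>r. tan (r / 2))"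
    by (intro continuous_intros ballI less_imp_neq[THEN not_sym] cos_gt_zero_pi) (use R in auto)
  have tpos: "tan (r / 2) > 0" if "0 < r" "r \<le> R" for r
    using that R by (intro tan_gt_zero) auto
  define W where "W r = tan (r / 2) ^ m * (s r - m * y r)" for r
  have W: "W r = 0" if r: "0 < r" "r \<le> R" for r
  proof -
    have "W r = W 0"
    proof (rule DERIV_isconst_end[OF r(1)])
      show "continuous_on {0..r} W" unfolding W_def
        by (rule continuous_on_subset[of "{0..R}"]) (use r in \<open>auto intro!: continuous_intros tan_cont cont\<close>)
      fix x assume x: "0 < x" "x < r"
      then have sx: "sin x > 0" using r R by (auto intro: sin_gt_zero)
      have "(W has_real_derivative m * tan (x / 2) ^ m / sin x * (s x - m * y x) +
          ((real m)\<^sup>2 * y x / sin x - m * (s x / sin x)) * tan (x / 2) ^ m) (at x)"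
        unfolding W_def using x r R
        by (intro DERIV_mult DERIV_diff DERIV_cmult tan_half_has_derivative dy ds) auto
      then show "(W has_real_derivative 0) (at x)"
        by (rule DERIV_cong) (use sx in \<open>simp add: field_simps power2_eq_square\<close>)
    qed
    \<comment> \<open>If \<open>m > 0\<close> the factor \<open>tan 0 ^ m\<close> vanishes; if
      \<open>m = 0\<close> it is 1 and \<open>s 0 = 0\<close> is what counts.\<close>
    then show ?thesis using s0 by (cases m) (auto simp: W_def)
  qed
  have s: "s r = m * y r" if "0 < r" "r \<le> R" for r
    using W[OF that] tpos[OF that] by (simp add: W_def)
  define C where "C = y R / tan (R / 2) ^ m"
  have "y r = C * tan (r / 2) ^ m" if r: "0 < r" "r \<le> R" for r
  proof (cases "r = R")
    case True
    then show ?thesis using tpos[of R] R by (simp add: C_def)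
  next
    case False
    \<comment> \<open>Since s = m y, the first equation reads y' = m y / sin r, which
      \<open>tan (r / 2) ^ m\<close> solves as well.\<close>
    have "y R / tan (R / 2) ^ m = y r / tan (r / 2) ^ m"
    proof (rule DERIV_isconst_end[of r R "\<lambda>r. y r / tan (r / 2) ^ m"])
      show "r < R" using False r by simp
      have sub: "{r..R} \<subseteq> {0..R}" using r by auto
      show "continuous_on {r..R} (\<lambda>r. y r / tan (r / 2) ^ m)"
        using tpos r
        by (intro continuous_intros continuous_on_subset[OF cont(1) sub] continuous_on_subset[OF tan_cont sub])
          (auto simp: less_imp_neq[THEN not_sym])
      fix x assume x: "r < x" "x < R"
      then have x0: "0 < x" using r by simp
      have sx: "sin x > 0" using x x0 R by (auto intro: sin_gt_zero)
      have "((\<lambda>r. y r / tan (r / 2) ^ m) has_real_derivative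
         ((s x / sin x) * tan (x / 2) ^ m - y x * (m * tan (x / 2) ^ m / sin x)) /
         (tan (x / 2) ^ m * tan (x / 2) ^ m)) (at x)"
        using x x0 R tpos[of x]
        by (intro DERIV_divide tan_half_has_derivative dy) auto
      then show "((\<lambda>r. y r / tan (r / 2) ^ m) has_real_derivative 0) (at x)"
        by (rule DERIV_cong) (use sx s[of x] x x0 in \<open>simp add: field_simps\<close>)
    qed
    then show ?thesis using tpos[OF r] by (simp add: C_def)
  qed
  then show thesis using s by (rule that)
qed

lemma continuous_on_slice:
  assumes "continuous_on (A \<times> B) (\<lambda>x. F (fst x) (snd x))" "a \<in> A"
  shows "continuous_on B (F a)"
proof -
  have "continuous_on B (\<lambda>y. (a, y))" by (intro continuous_intros)
  from continuous_on_compose2[OF assms(1) this] show ?thesis using assms(2) by auto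
qed

section \<open>Angular modes of functions on the disk\<close>

context polar_frame
begin

definition mode :: "(real \<Rightarrow> real) \<Rightarrow> (real \<Rightarrow> real \<Rightarrow> real) \<Rightarrow> real \<Rightarrow> real" where
  "mode \<phi> F r = integral {0..2*pi} (\<lambda>\<theta>. F r \<theta> * \<phi> \<theta>)"

lemma mode_has_derivative:
  assumes \<phi>: "continuous_on {0..2*pi} \<phi>" and R: "r \<in> {0..R}"
    and F: "continuous_on ({0..R} \<times> {0..2*pi}) (\<lambda>x. F (fst x) (snd x))"
      "continuous_on ({0..R} \<times> {0..2*pi}) (\<lambda>x. F' (fst x) (snd x))"
    and dF: "\<And>r \<theta>. r \<in> {0..R} \<Longrightarrow> ((\<lambda>r. F r \<theta>) has_real_derivative F' r \<theta>) (at r)"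
  shows "(mode \<phi> F has_real_derivative mode \<phi> F' r) (at r within {0..R})"
proof -
  have "((\<lambda>r. integral (cbox 0 (2*pi)) (\<lambda>\<theta>. F r \<theta> * \<phi> \<theta>)) has_real_derivative
      integral (cbox 0 (2*pi)) (\<lambda>\<theta>. F' r \<theta> * \<phi> \<theta>)) (at r within {0..R})"
  proof (rule leibniz_rule_field_derivative[OF _ _ _ R])
    show "((\<lambda>r. F r \<theta> * \<phi> \<theta>) has_real_derivative F' r \<theta> * \<phi> \<theta>) (at r within {0..R})" if "r \<in> {0..R}" for r \<theta>
      by (rule DERIV_cmult_right[OF DERIV_subset[OF dF[OF that]]]) simp
    show "(\<lambda>\<theta>. F r \<theta> * \<phi> \<theta>) integrable_on cbox 0 (2*pi)" if "r \<in> {0..R}" for r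
      using continuous_on_slice[OF F(1) that] \<phi>
      by (auto intro!: integrable_continuous_interval continuous_intros)
    show "continuous_on ({0..R} \<times> cbox 0 (2*pi)) (\<lambda>(r, \<theta>). F' r \<theta> * \<phi> \<theta>)"
      unfolding split_beta cbox_interval
      by (rule continuous_on_mult[OF F(2) continuous_on_compose2[OF \<phi>]])
        (auto intro: continuous_on_snd)
  qed auto
  then show ?thesis unfolding mode_def[abs_def] by simp
qed

lemma pol_periodic: "pol r (2*pi) = pol r 0" "pol_th r (2*pi) = pol_th r 0"
  by (simp_all add: pol_def pol_th_def)

text \<open>Two integrations by parts in theta move the second angular derivative onto
  \<open>\<phi>\<close>, where it becomes multiplication by \<open>- (real m)\<^sup>2\<close>; the
  boundary terms cancel by periodicity.\<close>

lemma mode_polar: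
  assumes U: "open U" and f: "Ck_on (Suc (Suc 0)) U f"
    and in_U: "case_prod pol ` ({0..R} \<times> UNIV) \<subseteq> U"
    and \<phi>: "\<And>\<theta>. (\<phi> has_real_derivative \<phi>' \<theta>) (at \<theta>)"
      "\<And>\<theta>. (\<phi>' has_real_derivative - ((real m)\<^sup>2 * \<phi> \<theta>)) (at \<theta>)" "\<phi> (2*pi) = \<phi> 0" "\<phi>' (2*pi) = \<phi>' 0"
    and r: "r \<in> {0..R}"
  shows "(mode \<phi> (\<lambda>r \<theta>. f (pol r \<theta>)) has_real_derivative mode \<phi> (f_r f) r) (at r within {0..R})"
    and "(mode \<phi> (f_r f) has_real_derivative mode \<phi> (f_rr f) r) (at r within {0..R})"
    and "(sin r)\<^sup>2 * mode \<phi> (f_rr f) r + sin r * cos r * mode \<phi> (f_r f) r =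
      (real m)\<^sup>2 * mode \<phi> (\<lambda>r \<theta>. f (pol r \<theta>)) r +
      (sin r)\<^sup>2 * mode \<phi> (\<lambda>r \<theta>. sphere_laplacian f (pol r \<theta>)) r"
proof -
  have in_U': "pol r \<theta> \<in> U" if "r \<in> {0..R}" for r \<theta>
  proof -
    have "case_prod pol (r, \<theta>) \<in> U" by (rule subsetD[OF in_U imageI]) (use that in simp)
    then show ?thesis by simp
  qed
  have c\<phi>: "continuous_on S \<phi>" "continuous_on S \<phi>'" for S
    using \<phi>(1,2) by (meson DERIV_isCont continuous_at_imp_continuous_on)+
  have S: "pol (fst x) (snd x) \<in> U" if "x \<in> {0..R} \<times> {0..2*pi}" for x
    using that in_U' by auto
  note cont = continuous_on_polar[OF U f S]
  show "(mode \<phi> (\<lambda>r \<theta>. f (pol r \<theta>)) has_real_derivative mode \<phi> (f_r f) r) (at r within {0..R})"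
    by (rule mode_has_derivative[OF c\<phi>(1) r]) (use cont polar_deriv[OF U f in_U'] in auto)
  show "(mode \<phi> (f_r f) has_real_derivative mode \<phi> (f_rr f) r) (at r within {0..R})"
    by (rule mode_has_derivative[OF c\<phi>(1) r]) (use cont polar_deriv2[OF U f in_U'] in auto)
  have int: "(\<lambda>\<theta>. F r \<theta> * \<phi> \<theta>) integrable_on {0..2*pi}"
    if "continuous_on ({0..R} \<times> {0..2*pi}) (\<lambda>x. F (fst x) (snd x))" for F :: "real \<Rightarrow> real \<Rightarrow> real"
    by (intro integrable_continuous_interval continuous_on_mult continuous_on_slice[OF that r] c\<phi>)
  have parts: "integral {0..2*pi} (\<lambda>\<theta>. f_thth f r \<theta> * \<phi> \<theta> + (real m)\<^sup>2 * (f (pol r \<theta>) * \<phi> \<theta>)) = 0"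
  proof -
    let ?G = "\<lambda>\<theta>. f_th f r \<theta> * \<phi> \<theta> - f (pol r \<theta>) * \<phi>' \<theta>"
    have "((\<lambda>\<theta>. f_thth f r \<theta> * \<phi> \<theta> + (real m)\<^sup>2 * (f (pol r \<theta>) * \<phi> \<theta>)) has_integral ?G (2*pi) - ?G 0) {0..2*pi}"
    proof (rule fundamental_theorem_of_calculus)
      fix \<theta> :: real
      note d = DERIV_mult[OF polar_deriv2(2)[OF U f in_U'[OF r]] \<phi>(1)]
        DERIV_mult[OF polar_deriv(2)[OF U f in_U'[OF r]] \<phi>(2)]
      have "(?G has_real_derivative f_thth f r \<theta> * \<phi> \<theta> + (real m)\<^sup>2 * (f (pol r \<theta>) * \<phi> \<theta>)) (at \<theta>)"
        by (rule DERIV_cong[OF DERIV_diff[OF d]]) (simp add: algebra_simps)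
      then show "(?G has_vector_derivative f_thth f r \<theta> * \<phi> \<theta> + (real m)\<^sup>2 * (f (pol r \<theta>) * \<phi> \<theta>)) (at \<theta> within {0..2*pi})"
        by (simp add: has_real_derivative_iff_has_vector_derivative has_vector_derivative_at_within)
    qed simp
    moreover have "?G (2*pi) = ?G 0" using \<phi>(3,4) by (simp add: f_th_def pol_periodic)
    ultimately show ?thesis by (simp add: integral_unique)
  qed
  note i = int[OF cont(4)] int[OF cont(2)] int[OF cont(5)] int[OF cont(1)]
  have th: "integral {0..2*pi} (\<lambda>\<theta>. f_thth f r \<theta> * \<phi> \<theta>) = - ((real m)\<^sup>2 * mode \<phi> (\<lambda>r \<theta>. f (pol r \<theta>)) r)"
    using parts integral_add[OF i(3) integrable_on_mult_right[OF i(4), of "(real m)\<^sup>2"]]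
    unfolding mode_def integral_mult_right by linarith
  have "((\<lambda>\<theta>. (sin r)\<^sup>2 * (f_rr f r \<theta> * \<phi> \<theta>) + sin r * cos r * (f_r f r \<theta> * \<phi> \<theta>) + f_thth f r \<theta> * \<phi> \<theta>)
      has_integral (sin r)\<^sup>2 * mode \<phi> (f_rr f) r + sin r * cos r * mode \<phi> (f_r f) r
      - (real m)\<^sup>2 * mode \<phi> (\<lambda>r \<theta>. f (pol r \<theta>)) r) {0..2*pi}"
    unfolding diff_conv_add_uminus th[symmetric] mode_def[of \<phi> "f_rr f"] mode_def[of \<phi> "f_r f"]
    by (intro has_integral_add has_integral_mult_right integrable_integral i)
  moreover have "((sin r)\<^sup>2 * (f_rr f r \<theta> * \<phi> \<theta>) + sin r * cos r * (f_r f r \<theta> * \<phi> \<theta>) + f_thth f r \<theta> * \<phi> \<theta>)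
      = (sin r)\<^sup>2 * (sphere_laplacian f (pol r \<theta>) * \<phi> \<theta>)" for \<theta>
    unfolding mult.assoc[symmetric, of "(sin r)\<^sup>2" "sphere_laplacian f (pol r \<theta>)"]
      polar_deriv2(3)[OF U f in_U'[OF r]]
    by (simp only: distrib_right mult.assoc)
  ultimately have "((\<lambda>\<theta>. (sin r)\<^sup>2 * (sphere_laplacian f (pol r \<theta>) * \<phi> \<theta>))
      has_integral (sin r)\<^sup>2 * mode \<phi> (f_rr f) r + sin r * cos r * mode \<phi> (f_r f) r
      - (real m)\<^sup>2 * mode \<phi> (\<lambda>r \<theta>. f (pol r \<theta>)) r) {0..2*pi}"
    by (simp only:)
  from integral_unique[OF this]
  have "(sin r)\<^sup>2 * mode \<phi> (\<lambda>r \<theta>. sphere_laplacian f (pol r \<theta>)) r =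
      (sin r)\<^sup>2 * mode \<phi> (f_rr f) r + sin r * cos r * mode \<phi> (f_r f) r
      - (real m)\<^sup>2 * mode \<phi> (\<lambda>r \<theta>. f (pol r \<theta>)) r"
    unfolding mode_def[of \<phi> "\<lambda>r \<theta>. sphere_laplacian f (pol r \<theta>)"] integral_mult_right .
  then show "(sin r)\<^sup>2 * mode \<phi> (f_rr f) r + sin r * cos r * mode \<phi> (f_r f) r =
      (real m)\<^sup>2 * mode \<phi> (\<lambda>r \<theta>. f (pol r \<theta>)) r +
      (sin r)\<^sup>2 * mode \<phi> (\<lambda>r \<theta>. sphere_laplacian f (pol r \<theta>)) r"
    by simp
qed

text \<open>Recasts the radial equation as the system for a mode and its flux on which
  \<open>radial_ode_unique\<close> operates: differential equations in the open interval, continuity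
  up to both ends.\<close>

lemma mode_flux_has_derivative:
  assumes U: "open U" and f: "Ck_on (Suc (Suc 0)) U f" and R: "R < pi"
    and in_U: "case_prod pol ` ({0..R} \<times> UNIV) \<subseteq> U"
    and \<phi>: "\<And>\<theta>. (\<phi> has_real_derivative \<phi>' \<theta>) (at \<theta>)"
      "\<And>\<theta>. (\<phi>' has_real_derivative - ((real m)\<^sup>2 * \<phi> \<theta>)) (at \<theta>)" "\<phi> (2*pi) = \<phi> 0" "\<phi>' (2*pi) = \<phi>' 0"
  shows "continuous_on {0..R} (mode \<phi> (\<lambda>r \<theta>. f (pol r \<theta>)))"
    and "continuous_on {0..R} (\<lambda>r. sin r * mode \<phi> (f_r f) r)"
    and "0 < r \<Longrightarrow> r < R \<Longrightarrow> (mode \<phi> (\<lambda>r \<theta>. f (pol r \<theta>)) has_real_derivative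
      (sin r * mode \<phi> (f_r f) r) / sin r) (at r)"
    and "0 < r \<Longrightarrow> r < R \<Longrightarrow> ((\<lambda>r. sin r * mode \<phi> (f_r f) r) has_real_derivative
      (real m)\<^sup>2 * mode \<phi> (\<lambda>r \<theta>. f (pol r \<theta>)) r / sin r +
      sin r * mode \<phi> (\<lambda>r \<theta>. sphere_laplacian f (pol r \<theta>)) r) (at r)"
proof -
  note m = mode_polar[OF U f in_U \<phi>]
  show "continuous_on {0..R} (mode \<phi> (\<lambda>r \<theta>. f (pol r \<theta>)))"
    by (rule DERIV_continuous_on[OF m(1)])
  have "continuous_on {0..R} (mode \<phi> (f_r f))"
    by (rule DERIV_continuous_on[OF m(2)])
  then show "continuous_on {0..R} (\<lambda>r. sin r * mode \<phi> (f_r f) r)"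
    by (intro continuous_intros)
  assume r: "0 < r" "r < R"
  have at: "at r within {0..R} = at r" using r by (intro at_within_interior) auto
  have s: "sin r > 0" using r R by (auto intro: sin_gt_zero)
  have r': "r \<in> {0..R}" using r by simp
  show "(mode \<phi> (\<lambda>r \<theta>. f (pol r \<theta>)) has_real_derivative
      (sin r * mode \<phi> (f_r f) r) / sin r) (at r)"
    using m(1)[OF r'] s by (simp add: at)
  have "((\<lambda>r. sin r * mode \<phi> (f_r f) r) has_real_derivative
      cos r * mode \<phi> (f_r f) r + mode \<phi> (f_rr f) r * sin r) (at r)"
    using m(2)[OF r'] by (intro DERIV_mult DERIV_sin) (simp add: at)
  moreover have "cos r * mode \<phi> (f_r f) r + mode \<phi> (f_rr f) r * sin r =
      (real m)\<^sup>2 * mode \<phi> (\<lambda>r \<theta>. f (pol r \<theta>)) r / sin r +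
      sin r * mode \<phi> (\<lambda>r \<theta>. sphere_laplacian f (pol r \<theta>)) r"
    using m(3)[OF r'] s by (simp add: field_simps power2_eq_square)
  ultimately show "((\<lambda>r. sin r * mode \<phi> (f_r f) r) has_real_derivative
      (real m)\<^sup>2 * mode \<phi> (\<lambda>r \<theta>. f (pol r \<theta>)) r / sin r +
      sin r * mode \<phi> (\<lambda>r \<theta>. sphere_laplacian f (pol r \<theta>)) r) (at r)"
    by simp
qed

text \<open>
  \<open>K\<close> is a particular solution of the radial equation with right-hand side \<open>tan (r/2) ^ m\<close> and \<open>S\<close>
  is \<open>sin r\<close> times its derivative.
\<close>

lemma steklov_mode_vanishes:
  assumes U: "open U" and u: "Ck_on 4 U u" and R: "0 < R" "R < pi"
    and in_U: "case_prod pol ` ({0..R} \<times> UNIV) \<subseteq> U"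
    and biharm: "\<And>r \<theta>. r \<in> {0..R} \<Longrightarrow> sphere_laplacian (sphere_laplacian u) (pol r \<theta>) = 0"
    and bdry: "\<And>\<theta>. u (pol R \<theta>) = 0" "\<And>\<theta>. sphere_laplacian u (pol R \<theta>) = \<eta> * f_r u R \<theta>"
    and \<phi>: "\<And>\<theta>. (\<phi> has_real_derivative \<phi>' \<theta>) (at \<theta>)"
      "\<And>\<theta>. (\<phi>' has_real_derivative - ((real m)\<^sup>2 * \<phi> \<theta>)) (at \<theta>)" "\<phi> (2*pi) = \<phi> 0" "\<phi>' (2*pi) = \<phi>' 0"
    and K: "continuous_on {0..R} K" "continuous_on {0..R} S" "S 0 = 0"
      "\<And>r. 0 < r \<Longrightarrow> r < R \<Longrightarrow> (K has_real_derivative S r / sin r) (at r)"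
      "\<And>r. 0 < r \<Longrightarrow> r < R \<Longrightarrow>
        (S has_real_derivative (real m)\<^sup>2 * K r / sin r + sin r * tan (r / 2) ^ m) (at r)"
    and \<eta>: "\<eta> * (S R - m * K R) \<noteq> tan (R / 2) ^ m * sin R"
    and r: "0 < r" "r \<le> R"
  shows "integral {0..2*pi} (\<lambda>\<theta>. u (pol r \<theta>) * \<phi> \<theta>) = 0"
proof -
  let ?v = "sphere_laplacian u"
  have u4: "Ck_on (Suc (Suc (Suc (Suc 0)))) U u" using u by (simp add: numeral_eq_Suc)
  have v2: "Ck_on (Suc (Suc 0)) U ?v" by (rule Ck_on_sphere_laplacian[OF U u4])
  have u2: "Ck_on (Suc (Suc 0)) U u" using Ck_on_SucD[OF U Ck_on_SucD[OF U u4]] .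
  define a where "a = mode \<phi> (\<lambda>r \<theta>. u (pol r \<theta>))"
  define b where "b = mode \<phi> (\<lambda>r \<theta>. ?v (pol r \<theta>))"
  define sa where "sa r = sin r * mode \<phi> (f_r u) r" for r
  define sb where "sb r = sin r * mode \<phi> (f_r ?v) r" for r
  note A = mode_flux_has_derivative[OF U u2 R(2) in_U \<phi>, folded a_def b_def sa_def]
  note B = mode_flux_has_derivative[OF U v2 R(2) in_U \<phi>, folded b_def sb_def]
  have "mode \<phi> (\<lambda>r \<theta>. sphere_laplacian ?v (pol r \<theta>)) r = 0" if "0 < r" "r < R" for r
    using biharm that by (simp add: mode_def)
  then have sb': "(sb has_real_derivative (real m)\<^sup>2 * b r / sin r) (at r)" if "0 < r" "r < R" for r
    using B(4)[OF that] that by simp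
  \<comment> \<open>The Laplacian of \<open>u\<close> is harmonic, so its mode is a multiple of
    \<open>tan (r / 2) ^ m\<close>; subtracting \<open>C * K\<close> from the mode of
    \<open>u\<close> then leaves a solution of the homogeneous system.\<close>
  obtain C where C: "\<And>r. 0 < r \<Longrightarrow> r \<le> R \<Longrightarrow> b r = C * tan (r / 2) ^ m"
  proof (rule radial_ode_unique[OF R B(1,2) _ B(3) sb'])
    show "sb 0 = 0" by (simp add: sb_def)
    fix C assume "\<And>r. 0 < r \<Longrightarrow> r \<le> R \<Longrightarrow> b r = C * tan (r / 2) ^ m"
    then show thesis by (rule that)
  qed
  obtain D where D: "\<And>r. 0 < r \<Longrightarrow> r \<le> R \<Longrightarrow> a r - C * K r = D * tan (r / 2) ^ m"
    "\<And>r. 0 < r \<Longrightarrow> r \<le> R \<Longrightarrow> sa r - C * S r = m * (a r - C * K r)"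
  proof (rule radial_ode_unique[OF R, of "\<lambda>r. a r - C * K r" "\<lambda>r. sa r - C * S r" m])
    show "continuous_on {0..R} (\<lambda>r. a r - C * K r)" "continuous_on {0..R} (\<lambda>r. sa r - C * S r)"
      by (intro continuous_intros A(1,2) K(1,2))+
    show "sa 0 - C * S 0 = 0" by (simp add: sa_def K)
    fix r assume r: "0 < r" "r < R"
    show "((\<lambda>r. a r - C * K r) has_real_derivative (sa r - C * S r) / sin r) (at r)"
      using DERIV_diff[OF A(3)[OF r] DERIV_cmult[OF K(4)[OF r], of C]] by (simp add: diff_divide_distrib)
    show "((\<lambda>r. sa r - C * S r) has_real_derivative (real m)\<^sup>2 * (a r - C * K r) / sin r) (at r)"
      by (rule DERIV_cong[OF DERIV_diff[OF A(4)[OF r] DERIV_cmult[OF K(5)[OF r], of C]]])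
        (use r in \<open>simp add: C algebra_simps diff_divide_distrib\<close>)
  next
    fix D assume "\<And>r. 0 < r \<Longrightarrow> r \<le> R \<Longrightarrow> a r - C * K r = D * tan (r / 2) ^ m"
      "\<And>r. 0 < r \<Longrightarrow> r \<le> R \<Longrightarrow> sa r - C * S r = m * (a r - C * K r)"
    then show thesis by (rule that)
  qed
  have aR: "a R = 0" using bdry(1) by (simp add: a_def mode_def)
  have "b R = \<eta> * mode \<phi> (f_r u) R"
    using bdry(2) by (simp add: b_def mode_def mult.assoc)
  then have "b R * sin R = \<eta> * sa R" by (simp add: sa_def)
  \<comment> \<open>The flux of \<open>a - C * K\<close> is \<open>m\<close> times
    \<open>a - C * K\<close>, and \<open>a R = 0\<close>; this eliminates \<open>D\<close> from the
    boundary condition.\<close>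
  moreover have "sa R = C * (S R - m * K R)"
    using D(2)[of R] R aR by (simp add: algebra_simps)
  ultimately have "C * (tan (R / 2) ^ m * sin R) = C * (\<eta> * (S R - m * K R))"
    using C[of R] R by (simp add: mult_ac)
  then have C0: "C = 0" using \<eta> by simp
  have "tan (R / 2) > 0" using R by (intro tan_gt_zero) auto
  then have "D = 0" using D(1)[of R] aR C0 R by simp
  then have "a r = 0" using D(1)[OF r] C0 by simp
  then show ?thesis by (simp add: a_def mode_def)
qed

lemma circle_modes_vanish:
  assumes U: "open U" and u: "continuous_on U u" and in_U: "\<And>\<theta>. pol r \<theta> \<in> U"
    and c: "\<And>m. integral {0..2*pi} (\<lambda>\<theta>. u (pol r \<theta>) * cos (real m * \<theta>)) = 0"
    and s: "\<And>m. integral {0..2*pi} (\<lambda>\<theta>. u (pol r \<theta>) * sin (real m * \<theta>)) = 0"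
  shows "u (pol r \<theta>) = 0"
proof -
  \<comment> \<open>An affine map of the real and imaginary parts of \<open>z\<close> that
    parametrises the circle of radius \<open>r\<close>, so that \<open>u\<close> becomes a
    continuous function on the unit circle.\<close>
  define P where "P z = cos r *\<^sub>R c + (sin r * Re z) *\<^sub>R e1 + (sin r * Im z) *\<^sub>R e2" for z
  have P: "P (cis t) = pol r t" for t by (simp add: P_def pol_def)
  have im: "P ` sphere 0 1 \<subseteq> U"
  proof
    fix p assume "p \<in> P ` sphere 0 1"
    then obtain z where z: "norm z = 1" "p = P z" by auto
    have "(Re z)\<^sup>2 + (Im z)\<^sup>2 = 1" using z by (simp add: cmod_def)
    then obtain t where "Re z = cos t" "Im z = sin t" using sincos_total_2pi by metis
    then have "z = cis t" by (simp add: complex_eq_iff)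
    then show "p \<in> U" using z P in_U by simp
  qed
  have "continuous_on (sphere 0 1) P" unfolding P_def by (intro continuous_intros)
  then have "continuous_on (sphere 0 1) (\<lambda>z. u (P z))" by (rule continuous_on_compose2[OF u _ im])
  from trig_complete[OF this, of "cis \<theta>"] show ?thesis using c s by (simp add: P)
qed

end

section \<open>The radial power series\<close>

text \<open>The index \<open>n\<close> counts derivatives, which yields the sequence that
  \<open>Ck_on_compose_real\<close> asks for.\<close>

definition pow_ser :: "(nat \<Rightarrow> real) \<Rightarrow> nat \<Rightarrow> real \<Rightarrow> real" where
  "pow_ser a n w = (\<Sum>j. (diffs ^^ n) a j * w ^ j)"

lemma pow_ser:
  assumes a: "\<And>j. \<bar>a j\<bar> \<le> 1" and w: "\<bar>w\<bar> < 1"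
  shows "summable (\<lambda>j. (diffs ^^ n) a j * w ^ j)"
    and "(pow_ser a n has_real_derivative pow_ser a (Suc n) w) (at w)"
proof -
  have s: "summable (\<lambda>j. (diffs ^^ n) a j * w ^ j)" if "\<bar>w\<bar> < 1" for n w
    using that
  proof (induction n arbitrary: w)
    case 0
    have "summable (\<lambda>j. a j * w ^ j)"
    proof (rule summable_comparison_test)
      show "summable (\<lambda>j. \<bar>w\<bar> ^ j)" using 0 by (intro summable_geometric) simp
      have "norm (a j * w ^ j) \<le> \<bar>w\<bar> ^ j" for j
        using mult_right_mono[OF a[of j], of "\<bar>w\<bar> ^ j"] by (simp add: abs_mult power_abs)
      then show "\<exists>N. \<forall>n\<ge>N. norm (a n * w ^ n) \<le> \<bar>w\<bar> ^ n" by blast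
    qed
    then show ?case by simp
  next
    case (Suc n)
    show ?case using termdiff_converges[of w 1 "(diffs ^^ n) a"] Suc by simp
  qed
  show "summable (\<lambda>j. (diffs ^^ n) a j * w ^ j)" using s[OF w] .
  show "(pow_ser a n has_real_derivative pow_ser a (Suc n) w) (at w)"
    unfolding pow_ser_def[abs_def] using termdiffs_strong'[of 1 "(diffs ^^ n) a" w] s w by simp
qed

text \<open>
  \<open>q_fun m\<close> is the solution of \<open>w (1 - w) q' + (m + 1 - 2 w) q = 1\<close> that is regular at 0, and
  \<open>k_fun m\<close> its primitive.
\<close>

definition q_coeff :: "nat \<Rightarrow> nat \<Rightarrow> real" where
  "q_coeff m n = fact (n + 1) * fact m / fact (n + m + 1)"

definition k_coeff :: "nat \<Rightarrow> nat \<Rightarrow> real" where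
  "k_coeff m n = (if n = 0 then 0 else q_coeff m (n - 1) / n)"

definition q_fun :: "nat \<Rightarrow> real \<Rightarrow> real" where "q_fun m w = pow_ser (q_coeff m) 0 w"
definition q_deriv :: "nat \<Rightarrow> real \<Rightarrow> real" where "q_deriv m w = pow_ser (q_coeff m) 1 w"
definition k_fun :: "nat \<Rightarrow> real \<Rightarrow> real" where "k_fun m w = pow_ser (k_coeff m) 0 w"

lemma q_coeff_pos: "q_coeff m n > 0"
  by (simp add: q_coeff_def)

text \<open>The recurrence that the differential equation imposes. Together with
  \<open>q_coeff_0\<close> it identifies \<open>q_fun m\<close> as the hypergeometric function F(1,
  2; m + 2; w) divided by m + 1.\<close>

lemma q_coeff_Suc: "q_coeff m (Suc n) * (real n + m + 2) = (real n + 2) * q_coeff m n"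
proof -
  have e: "fact (Suc n + m + 1) = (real n + m + 2) * fact (n + m + 1)" "fact (Suc n + 1) = (real n + 2) * fact (n + 1)"
    by (simp_all add: fact_Suc algebra_simps)
  have gen: "x * a * b / (y * z) * y = x * (a * b / z)" if "y > 0" for x a b y z :: real
    using that by simp
  show ?thesis unfolding q_coeff_def e by (rule gen) simp
qed

lemma q_coeff_Suc_m: "q_coeff (Suc m) n * (real n + m + 2) = (real m + 1) * q_coeff m n"
proof -
  have e: "fact (n + Suc m + 1) = (real n + m + 2) * fact (n + m + 1)" "fact (Suc m) = (real m + 1) * fact m"
    by (simp_all add: fact_Suc algebra_simps)
  have gen: "a * (x * b) / (y * z) * y = x * (a * b / z)" if "y > 0" for x a b y z :: real
    using that by simp
  show ?thesis unfolding q_coeff_def e by (rule gen) simp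
qed

lemma q_coeff_0: "q_coeff m 0 = 1 / (real m + 1)"
proof -
  have "fact (0 + m + 1) = (real m + 1) * fact m" by simp
  then show ?thesis unfolding q_coeff_def by simp
qed

lemma q_coeff_le_1: "q_coeff m n \<le> 1"
proof (induction n)
  case (Suc n)
  have "(real n + 2) * q_coeff m n \<le> (real n + m + 2) * 1"
    by (rule mult_mono) (use Suc q_coeff_pos[of m n] in auto)
  then have "q_coeff m (Suc n) * (real n + m + 2) \<le> 1 * (real n + m + 2)"
    unfolding q_coeff_Suc by simp
  then show ?case by (rule mult_right_le_imp_le) simp
qed (simp add: q_coeff_0)

lemma abs_q_coeff: "\<bar>q_coeff m n\<bar> \<le> 1"
  using q_coeff_pos[of m n] q_coeff_le_1[of m n] by simp

lemma abs_k_coeff: "\<bar>k_coeff m n\<bar> \<le> 1"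
proof (cases n)
  case (Suc j)
  have "q_coeff m j / real n \<le> q_coeff m j / 1"
    using q_coeff_pos[of m j] Suc by (intro divide_left_mono) auto
  then show ?thesis using Suc q_coeff_le_1[of m j] q_coeff_pos[of m j] by (simp add: k_coeff_def)
qed (simp add: k_coeff_def)

lemma diffs_k_coeff: "diffs (k_coeff m) = q_coeff m"
  by (simp add: fun_eq_iff diffs_def k_coeff_def)

lemma q_has_derivative: "\<bar>w\<bar> < 1 \<Longrightarrow> (q_fun m has_real_derivative q_deriv m w) (at w)"
  using pow_ser(2)[of "q_coeff m" w 0] by (simp add: q_fun_def[abs_def] q_deriv_def abs_q_coeff)

lemma k_has_derivative: "\<bar>w\<bar> < 1 \<Longrightarrow> (k_fun m has_real_derivative q_fun m w) (at w)"
proof -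
  assume w: "\<bar>w\<bar> < 1"
  have "pow_ser (k_coeff m) (Suc 0) w = q_fun m w" by (simp add: pow_ser_def q_fun_def diffs_k_coeff)
  then show ?thesis
    using pow_ser(2)[of "k_coeff m" w 0] w by (simp add: k_fun_def[abs_def] abs_k_coeff)
qed

lemma q_sums:
  assumes "\<bar>w\<bar> < 1"
  shows "(\<lambda>n. q_coeff m n * w ^ n) sums q_fun m w"
    and "(\<lambda>n. (n + 1) * q_coeff m (n + 1) * w ^ n) sums q_deriv m w"
    and "(\<lambda>n. n * q_coeff m n * w ^ n) sums (w * q_deriv m w)"
proof -
  show "(\<lambda>n. q_coeff m n * w ^ n) sums q_fun m w"
    using summable_sums[OF pow_ser(1)[of "q_coeff m" w 0]] assms
    by (simp add: abs_q_coeff q_fun_def pow_ser_def)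
  show s: "(\<lambda>n. (n + 1) * q_coeff m (n + 1) * w ^ n) sums q_deriv m w"
    using summable_sums[OF pow_ser(1)[of "q_coeff m" w 1]] assms
    by (simp add: abs_q_coeff q_deriv_def pow_ser_def diffs_def add.commute)
  have "(\<lambda>n. real (Suc n) * q_coeff m (Suc n) * w ^ Suc n) sums (w * q_deriv m w)"
    using sums_mult[OF s, of w] by (simp add: mult_ac)
  then show "(\<lambda>n. n * q_coeff m n * w ^ n) sums (w * q_deriv m w)"
    using sums_Suc_iff[of "\<lambda>n. n * q_coeff m n * w ^ n"] by simp
qed

lemma q_ode:
  assumes w: "\<bar>w\<bar> < 1"
  shows "w * (1 - w) * q_deriv m w + (m + 1 - 2 * w) * q_fun m w = 1"
proof -
  note s = q_sums[OF w, of m]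
  \<comment> \<open>\<open>F\<close> is the series of w q' + (m + 1) q. By the recurrence its terms
    from index 1 on sum to w (w q' + 2 q), and \<open>F 0 = 1\<close> is the right-hand side of the
    equation.\<close>
  define F where "F n = (real n + m + 1) * q_coeff m n * w ^ n" for n
  have F: "F sums (w * q_deriv m w + (m + 1) * q_fun m w)"
    using sums_add[OF s(3) sums_mult[OF s(1), of "m + 1"]] unfolding F_def by (simp add: algebra_simps)
  have "F (Suc n) = w * (n * q_coeff m n * w ^ n) + 2 * w * (q_coeff m n * w ^ n)" for n
  proof -
    have "F (Suc n) = (q_coeff m (Suc n) * (real n + m + 2)) * (w * w ^ n)"
      by (simp add: F_def algebra_simps)
    also have "\<dots> = w * (n * q_coeff m n * w ^ n) + 2 * w * (q_coeff m n * w ^ n)"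
      unfolding q_coeff_Suc by (simp add: algebra_simps)
    finally show ?thesis .
  qed
  then have "(\<lambda>n. F (Suc n)) sums (w * (w * q_deriv m w) + 2 * w * q_fun m w)"
    using sums_add[OF sums_mult[OF s(3), of w] sums_mult[OF s(1), of "2 * w"]] by simp
  then have "F sums (w * (w * q_deriv m w) + 2 * w * q_fun m w + F 0)"
    by (simp add: sums_Suc_iff)
  then have "w * q_deriv m w + (m + 1) * q_fun m w = w * (w * q_deriv m w) + 2 * w * q_fun m w + F 0"
    using F sums_unique2 by blast
  moreover have "F 0 = 1" by (simp add: F_def q_coeff_0 field_simps)
  ultimately show ?thesis by (simp add: algebra_simps)
qed

section \<open>Signs and monotonicity read off the coefficients\<close>

lemma sums_pos:
  fixes f :: "nat \<Rightarrow> real"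
  assumes "f sums s" "\<And>n. f n \<ge> 0" "f i > 0"
  shows "s > 0"
proof -
  have f: "summable f" "suminf f = s" using assms(1) by (auto simp: sums_iff)
  have "suminf f > 0" by (rule suminf_pos2[OF f(1), of i]) (use assms in auto)
  then show ?thesis using f(2) by simp
qed

lemma q_pos: "0 \<le> w \<Longrightarrow> w < 1 \<Longrightarrow> q_fun m w > 0"
  by (rule sums_pos[OF q_sums(1), of w m 0]) (simp_all add: q_coeff_pos less_imp_le[OF q_coeff_pos])

lemma q_deriv_pos: "0 \<le> w \<Longrightarrow> w < 1 \<Longrightarrow> q_deriv m w > 0"
  by (rule sums_pos[OF q_sums(2), of w m 0]) (simp_all add: q_coeff_pos less_imp_le[OF q_coeff_pos])

lemma q_strict_mono:
  assumes "0 \<le> w" "w < w'" "w' < 1" shows "q_fun m w < q_fun m w'"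
proof (rule DERIV_pos_imp_increasing[OF assms(2)])
  fix x assume "w \<le> x" "x \<le> w'"
  then show "\<exists>y. (q_fun m has_real_derivative y) (at x) \<and> y > 0"
    using assms by (intro exI[of _ "q_deriv m x"] conjI q_has_derivative q_deriv_pos) auto
qed

text \<open>The n-th coefficient is multiplied by (m + 1) / (n + m + 2) < 1 when \<open>m\<close>
  grows by one. This orders the eigenvalues by angular frequency.\<close>

lemma q_Suc_less:
  assumes w: "0 \<le> w" "w < 1" shows "q_fun (Suc m) w < q_fun m w"
proof -
  have le: "q_coeff (Suc m) n \<le> q_coeff m n" for n
  proof -
    have "q_coeff (Suc m) n * (real n + m + 2) \<le> q_coeff m n * (real n + m + 2)"
      unfolding q_coeff_Suc_m using q_coeff_pos[of m n] by (simp add: mult.commute mult_left_mono)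
    then show ?thesis by (rule mult_right_le_imp_le) simp
  qed
  have "(\<lambda>n. q_coeff m n * w ^ n - q_coeff (Suc m) n * w ^ n) sums (q_fun m w - q_fun (Suc m) w)"
    by (intro sums_diff q_sums) (use w in auto)
  then have "q_fun m w - q_fun (Suc m) w > 0"
    by (rule sums_pos[of _ _ 0]) (use w le in \<open>auto simp: mult_right_mono q_coeff_0 frac_less2\<close>)
  then show ?thesis by simp
qed

text \<open>With a_n for \<open>q_coeff m n\<close>, minus the derivative has the coefficients (n +
  1) (a_n - a_(n+1)), and a_(n+1) / a_n = (n + 2) / (n + m + 2). For \<open>m = 0\<close> all a_n
  are 1 and the product is constant.\<close>

lemma q_times_one_minus_decreasing:
  assumes m: "m \<ge> 1" and w: "0 \<le> w" "w < w'" "w' < 1"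
  shows "q_fun m w' * (1 - w') < q_fun m w * (1 - w)"
proof (rule DERIV_neg_imp_decreasing[OF w(2)])
  fix x assume x: "w \<le> x" "x \<le> w'"
  then have x': "0 \<le> x" "x < 1" "\<bar>x\<bar> < 1" using w by auto
  have d: "((\<lambda>w. q_fun m w * (1 - w)) has_real_derivative q_deriv m x * (1 - x) - q_fun m x) (at x)"
    by (auto intro!: derivative_eq_intros q_has_derivative x')
  note s = q_sums[OF x'(3), of m]
  have "(\<lambda>n. real (n + 1) * (q_coeff m n - q_coeff m (n + 1)) * x ^ n) sums
      (x * q_deriv m x + q_fun m x - q_deriv m x)"
    using sums_diff[OF sums_add[OF s(3,1)] s(2)] by (simp add: algebra_simps)
  then have "x * q_deriv m x + q_fun m x - q_deriv m x > 0"
  proof (rule sums_pos[of _ _ 0])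
    have *: "q_coeff m (n + 1) < q_coeff m n" for n
    proof -
      have "q_coeff m (Suc n) * (real n + m + 2) < q_coeff m n * (real n + m + 2)"
        unfolding q_coeff_Suc using q_coeff_pos[of m n] m by (simp add: mult.commute)
      then have "q_coeff m (Suc n) < q_coeff m n" by (rule mult_right_less_imp_less) simp
      then show ?thesis by simp
    qed
    show "0 \<le> real (n + 1) * (q_coeff m n - q_coeff m (n + 1)) * x ^ n" for n
      using *[of n] x' by simp
    show "0 < real (0 + 1) * (q_coeff m 0 - q_coeff m (0 + 1)) * x ^ 0" using *[of 0] by simp
  qed
  then have "q_deriv m x * (1 - x) - q_fun m x < 0" by (simp add: algebra_simps)
  with d show "\<exists>y. ((\<lambda>w. q_fun m w * (1 - w)) has_real_derivative y) (at x) \<and> y < 0" by blast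
qed

definition g_fun :: "nat \<Rightarrow> real \<Rightarrow> real" where "g_fun m w = 2 * (1 - w) * q_deriv m w - q_fun m w"

text \<open>
  \<open>g_fun m\<close> has the sign of the derivative of \<open>q\<^sup>2 (1 - w)\<close>; for \<open>m \<ge> 1\<close> all but at most one of its
  Taylor coefficients are non-positive.
\<close>

lemma g_sums:
  assumes w: "\<bar>w\<bar> < 1"
  shows "(\<lambda>n. (n * (1 - 2 * real m) + 2 - m) / (n + m + 2) * q_coeff m n * w ^ n) sums g_fun m w"
proof -
  note s = q_sums[OF w, of m]
  have "(\<lambda>n. 2 * (real (n + 1) * q_coeff m (n + 1) * w ^ n) - 2 * (n * q_coeff m n * w ^ n) - q_coeff m n * w ^ n) sums
      (2 * q_deriv m w - 2 * (w * q_deriv m w) - q_fun m w)"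
    by (intro sums_diff sums_mult s)
  moreover have "2 * (real (n + 1) * q_coeff m (n + 1) * w ^ n) - 2 * (n * q_coeff m n * w ^ n) - q_coeff m n * w ^ n
      = (n * (1 - 2 * real m) + 2 - m) / (n + m + 2) * q_coeff m n * w ^ n" for n
  proof -
    have c: "q_coeff m (n + 1) = (real n + 2) * q_coeff m n / (real n + m + 2)"
      using q_coeff_Suc[of m n] by (subst eq_divide_eq) auto
    have "2 * (x + 1) * ((x + 2) * a / (x + y + 2)) - 2 * x * a - a = (x * (1 - 2 * y) + 2 - y) / (x + y + 2) * a"
      if "x + y + 2 \<noteq> 0" for x y a :: real
      using that by (simp add: field_simps)
    from this[of n m "q_coeff m n"]
    have "2 * (real n + 1) * q_coeff m (n + 1) - 2 * n * q_coeff m n - q_coeff m n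
      = (n * (1 - 2 * real m) + 2 - m) / (n + m + 2) * q_coeff m n"
      unfolding c by simp
    from arg_cong[OF this, of "\<lambda>z. z * w ^ n"] show ?thesis by (simp add: algebra_simps)
  qed
  moreover have "2 * q_deriv m w - 2 * (w * q_deriv m w) - q_fun m w = g_fun m w"
    by (simp add: g_fun_def algebra_simps)
  ultimately show ?thesis by simp
qed

lemma q_sq_has_derivative:
  assumes "\<bar>w\<bar> < 1"
  shows "((\<lambda>w. (q_fun m w)\<^sup>2 * (1 - w)) has_real_derivative q_fun m w * g_fun m w) (at w)"
  by (auto intro!: derivative_eq_intros q_has_derivative assms simp: g_fun_def power2_eq_square algebra_simps)

lemma g_neg:
  assumes m: "m \<ge> 2" and w: "0 < w" "w < 1" shows "g_fun m w < 0"
proof -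
  define c where "c n = - ((real n * (1 - 2 * real m) + 2 - real m) / real (n + m + 2) * q_coeff m n * w ^ n)" for n
  have "c sums (- g_fun m w)"
    unfolding c_def using sums_minus[OF g_sums[of w m]] w by simp
  moreover have "c n \<ge> 0" for n
  proof -
    have "real n * (1 - 2 * real m) + 2 - real m \<le> 0"
      using mult_nonneg_nonpos[of "real n" "1 - 2 * real m"] m by simp
    then show ?thesis unfolding c_def neg_0_le_iff_le
      using w q_coeff_pos[of m n] by (intro mult_nonpos_nonneg divide_nonpos_nonneg) auto
  qed
  \<comment> \<open>Index 1 and not 0: the constant coefficient vanishes for
    \<open>m = 2\<close>.\<close>
  moreover have "c 1 > 0"
    unfolding c_def neg_0_less_iff_less
    using m w q_coeff_pos[of m 1] by (intro mult_neg_pos divide_neg_pos) auto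
  ultimately have "- g_fun m w > 0" by (rule sums_pos)
  then show ?thesis by simp
qed

text \<open>For \<open>m = 1\<close> the n-th coefficient has the sign of 1 - n: the constant term
  cancels in the difference, the linear one is absent and all later ones are negative.\<close>

lemma g_1_decreasing:
  assumes w: "0 \<le> w" "w < w'" "w' < 1" shows "g_fun 1 w' < g_fun 1 w"
proof -
  let ?c = "\<lambda>n. (n * (1 - 2 * real 1) + 2 - real 1) / (real n + real 1 + 2) * q_coeff 1 n"
  have "(\<lambda>n. ?c n * w ^ n - ?c n * w' ^ n) sums (g_fun 1 w - g_fun 1 w')"
    by (intro sums_diff) (use g_sums[of w 1] g_sums[of w' 1] w in auto)
  then have "g_fun 1 w - g_fun 1 w' > 0"
  proof (rule sums_pos[of _ _ 2])
    fix n :: nat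
    show "0 \<le> ?c n * w ^ n - ?c n * w' ^ n"
    proof (cases "n = 0")
      case False
      then have "?c n \<le> 0" using q_coeff_pos[of 1 n]
        by (intro mult_nonpos_nonneg divide_nonpos_nonneg) auto
      moreover have "w ^ n \<le> w' ^ n" using w by (intro power_mono) auto
      ultimately show ?thesis using mult_left_mono_neg by fastforce
    qed simp
  next
    have "w\<^sup>2 < w'\<^sup>2" using w by (intro power_strict_mono) auto
    moreover have "?c 2 < 0" using q_coeff_pos[of 1 2] by simp
    ultimately show "0 < ?c 2 * w\<^sup>2 - ?c 2 * w'\<^sup>2" using mult_strict_left_mono_neg by fastforce
  qed
  then show ?thesis by simp
qed

lemma q_coeff_1: "q_coeff 1 n = 1 / (real n + 2)"
proof -
  have "fact (n + 1 + 1) = (real n + 2) * fact (n + 1)" by (simp add: algebra_simps)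
  then show ?thesis unfolding q_coeff_def by simp
qed

lemma g_1_sign_change:
  obtains w\<^sub>1 where "0 < w\<^sub>1" "w\<^sub>1 < 1" "\<And>w. 0 < w \<Longrightarrow> w < w\<^sub>1 \<Longrightarrow> g_fun 1 w > 0"
    "\<And>w. w\<^sub>1 < w \<Longrightarrow> w < 1 \<Longrightarrow> g_fun 1 w < 0"
proof -
  \<comment> \<open>By the differential equation, \<open>g_fun 1 w < 0\<close> amounts to \<open>q_fun 1 w > 2 / (4 - 3 w)\<close>.\<close>
  have neg: "g_fun 1 (9/10) < 0"
  proof -
    have "(\<Sum>n<20. q_coeff 1 n * (9/10) ^ n) \<le> q_fun 1 (9/10)"
      using sum_le_suminf[of "\<lambda>n. q_coeff 1 n * (9/10) ^ n" "{..<20}"] q_sums(1)[of "9/10" 1] q_coeff_pos[of 1]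
      by (auto simp: sums_iff less_imp_le)
    \<comment> \<open>The threshold at 9/10 is 20/13 < 8/5, and twenty terms of the series already
      exceed 8/5.\<close>
    moreover have "(\<Sum>n<20. q_coeff 1 n * (9/10) ^ n) > 8/5"
      unfolding q_coeff_1 by (simp add: lessThan_nat_numeral lessThan_Suc power_divide)
    ultimately have "q_fun 1 (9/10) > 8/5" by linarith
    then show ?thesis using q_ode[of "9/10" 1] by (simp add: g_fun_def field_simps)
  qed
  have pos: "g_fun 1 0 > 0"
    using g_sums[of 0 1] sums_unique2[of _ "g_fun 1 0"] powser_sums_zero[of "\<lambda>n. (n * (1 - 2 * real 1) + 2 - real 1) / (real n + real 1 + 2) * q_coeff 1 n"]
      q_coeff_pos[of 1 0] by fastforce
  have cont: "continuous_on {0..9/10} (g_fun 1)"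
  proof -
    have "isCont (q_fun 1) w" "isCont (q_deriv 1) w" if "w \<in> {0..9/10}" for w
      using that DERIV_isCont[OF q_has_derivative[of w 1]] DERIV_isCont[OF pow_ser(2)[of "q_coeff 1" w 1]]
      by (auto simp: q_deriv_def[abs_def] abs_q_coeff)
    then show ?thesis unfolding g_fun_def[abs_def]
      by (intro continuous_intros) (auto intro!: continuous_at_imp_continuous_on)
  qed
  obtain w\<^sub>1 where w1: "0 \<le> w\<^sub>1" "w\<^sub>1 \<le> 9/10" "g_fun 1 w\<^sub>1 = 0"
    using IVT2'[of "g_fun 1" "9/10" 0 0] neg pos cont by force
  have "w\<^sub>1 \<noteq> 0" using w1 pos by auto
  then show thesis
    using that[of w\<^sub>1] w1 g_1_decreasing[of _ w\<^sub>1] g_1_decreasing[of w\<^sub>1] by force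
qed

section \<open>Monotonicity of the eigenvalue branches\<close>

definition hw :: "real \<Rightarrow> real" where "hw R = (sin (R / 2))\<^sup>2"

definition eta :: "nat \<Rightarrow> real \<Rightarrow> real" where
  "eta m R = 2 / (q_fun m (hw R) * sin R)"

lemma hw_eqs: "1 - hw R = (cos (R / 2))\<^sup>2" "cos R = 1 - 2 * hw R" "(sin R)\<^sup>2 = 4 * hw R * (1 - hw R)"
  "sin R = 2 * sin (R / 2) * cos (R / 2)"
proof -
  show 1: "1 - hw R = (cos (R / 2))\<^sup>2" by (simp add: hw_def cos_squared_eq)
  show "cos R = 1 - 2 * hw R" using cos_double_sin[of "R / 2"] by (simp add: hw_def)
  show 2: "sin R = 2 * sin (R / 2) * cos (R / 2)" using sin_double[of "R / 2"] by simp
  show "(sin R)\<^sup>2 = 4 * hw R * (1 - hw R)" unfolding 1 unfolding 2 by (simp add: hw_def power_mult_distrib)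
qed

lemma half_pos: "0 < R \<Longrightarrow> R < pi \<Longrightarrow> sin (R / 2) > 0 \<and> cos (R / 2) > 0 \<and> sin R > 0"
  by (auto intro: sin_gt_zero cos_gt_zero)

lemma hw_bounds: assumes "0 < R" "R < pi" shows "0 < hw R" "hw R < 1" "0 \<le> hw R" "\<bar>hw R\<bar> < 1"
proof -
  show "0 < hw R" using half_pos[OF assms] by (simp add: hw_def)
  moreover show "hw R < 1" using half_pos[OF assms] hw_eqs(1)[of R] by (smt (verit) zero_less_power)
  ultimately show "0 \<le> hw R" "\<bar>hw R\<bar> < 1" by auto
qed

lemma hw_strict_mono: "0 < R \<Longrightarrow> R < R' \<Longrightarrow> R' < pi \<Longrightarrow> hw R < hw R'"
  unfolding hw_def by (intro power_strict_mono sin_monotone_2pi) (auto intro!: sin_ge_zero)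

lemma hw_has_derivative: "(hw has_real_derivative sin R / 2) (at R)"
  unfolding hw_def[abs_def] hw_eqs(4)[of R] by (auto intro!: derivative_eq_intros)

lemma q_hw_pos: "0 < R \<Longrightarrow> R < pi \<Longrightarrow> q_fun m (hw R) > 0"
  by (rule q_pos) (use hw_bounds in auto)

lemma q_hw_has_derivative:
  "0 < R \<Longrightarrow> R < pi \<Longrightarrow> ((\<lambda>R. q_fun m (hw R)) has_real_derivative q_deriv m (hw R) * (sin R / 2)) (at R)"
  using DERIV_chain2[OF q_has_derivative[OF hw_bounds(4)] hw_has_derivative] by blast

lemma eta_Suc: assumes "0 < R" "R < pi" shows "eta m R < eta (Suc m) R"
  unfolding eta_def
  using q_Suc_less[OF hw_bounds(3,2)[OF assms], of m] q_hw_pos[OF assms] half_pos[OF assms]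
  by (intro divide_strict_left_mono mult_strict_right_mono mult_pos_pos) auto

lemma eta_sin_decreasing: "strict_antimono_on {0<..<pi} (\<lambda>R. eta m R * sin R)"
proof (rule monotone_onI)
  fix R R' :: real assume R: "R \<in> {0<..<pi}" "R' \<in> {0<..<pi}" "R < R'"
  have e: "eta m R * sin R = 2 / q_fun m (hw R)" if "R \<in> {0<..<pi}" for R
    using half_pos[of R] that by (simp add: eta_def)
  have "q_fun m (hw R) < q_fun m (hw R')"
    by (intro q_strict_mono hw_strict_mono hw_bounds) (use R in auto)
  then show "eta m R' * sin R' < eta m R * sin R"
    unfolding e[OF R(1)] e[OF R(2)] using q_hw_pos[of _ m] R
    by (intro divide_strict_left_mono mult_pos_pos) auto
qed

lemma eta_tan_increasing:
  assumes m: "m \<ge> 1" shows "strict_mono_on {0<..<pi} (\<lambda>R. eta m R * tan (R / 2))"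
proof (rule monotone_onI)
  fix R R' :: real assume R: "R \<in> {0<..<pi}" "R' \<in> {0<..<pi}" "R < R'"
  have e: "eta m R * tan (R / 2) = 1 / (q_fun m (hw R) * (1 - hw R))" if "R \<in> {0<..<pi}" for R
    unfolding hw_eqs(1) using half_pos[of R] that q_hw_pos[of R m]
    by (simp add: eta_def hw_eqs(4)[of R] tan_def field_simps power2_eq_square)
  have "q_fun m (hw R') * (1 - hw R') < q_fun m (hw R) * (1 - hw R)"
    by (intro q_times_one_minus_decreasing m hw_strict_mono hw_bounds) (use R in auto)
  then show "eta m R * tan (R / 2) < eta m R' * tan (R' / 2)"
    unfolding e[OF R(1)] e[OF R(2)] using q_hw_pos[of _ m] hw_bounds(2) R
    by (intro divide_strict_left_mono mult_pos_pos) auto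
qed

text \<open>\<open>eta m R * sin (R / 2)\<close> is 1 / (q cos(R/2)); squaring turns the cosine of
  the half angle into \<open>1 - hw R\<close>, so that only functions of \<open>hw R\<close> have to
  be compared.\<close>

lemma eta_sin_half_less:
  assumes R: "R \<in> {0<..<pi}" "R' \<in> {0<..<pi}"
    and less: "(q_fun m (hw R'))\<^sup>2 * (1 - hw R') < (q_fun m (hw R))\<^sup>2 * (1 - hw R)"
  shows "eta m R * sin (R / 2) < eta m R' * sin (R' / 2)"
proof -
  have e: "eta m R * sin (R / 2) = 1 / (q_fun m (hw R) * cos (R / 2))" if "R \<in> {0<..<pi}" for R
    using half_pos[of R] that q_hw_pos[of R m] by (simp add: eta_def hw_eqs(4)[of R])
  have p: "q_fun m (hw R) * cos (R / 2) > 0" if "R \<in> {0<..<pi}" for R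
    using half_pos[of R] that q_hw_pos[of R m] by simp
  have "(q_fun m (hw R') * cos (R' / 2))\<^sup>2 < (q_fun m (hw R) * cos (R / 2))\<^sup>2"
    using less unfolding hw_eqs(1) power_mult_distrib .
  then have "q_fun m (hw R') * cos (R' / 2) < q_fun m (hw R) * cos (R / 2)"
    by (rule power2_less_imp_less) (use p[OF R(1)] in simp)
  then show ?thesis unfolding e[OF R(1)] e[OF R(2)]
    by (rule divide_strict_left_mono[OF _ _ mult_pos_pos[OF p[OF R(1)] p[OF R(2)]]]) simp
qed

lemma eta_sin_half_increasing:
  assumes m: "m \<ge> 2" shows "strict_mono_on {0<..<pi} (\<lambda>R. eta m R * sin (R / 2))"
proof (rule monotone_onI)
  fix R R' :: real assume R: "R \<in> {0<..<pi}" "R' \<in> {0<..<pi}" "R < R'"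
  show "eta m R * sin (R / 2) < eta m R' * sin (R' / 2)"
  proof (rule eta_sin_half_less[OF R(1,2)], rule DERIV_neg_imp_decreasing[where f = "\<lambda>w. (q_fun m w)\<^sup>2 * (1 - w)"])
    show "hw R < hw R'" using R by (intro hw_strict_mono) auto
    fix x assume "hw R \<le> x" "x \<le> hw R'"
    then have x: "0 < x" "x < 1" using hw_bounds[of R] hw_bounds[of R'] R by auto
    then show "\<exists>y. ((\<lambda>w. (q_fun m w)\<^sup>2 * (1 - w)) has_real_derivative y) (at x) \<and> y < 0"
      using q_sq_has_derivative[of x m] g_neg[OF m x] q_pos[of x m] by (auto simp: mult_pos_neg)
  qed
qed

lemma eta_1_sin_half:
  "\<exists>R\<^sub>1\<in>{0<..<pi}. strict_antimono_on {0<..<R\<^sub>1} (\<lambda>R. eta 1 R * sin (R / 2)) \<and>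
     strict_mono_on {R\<^sub>1<..<pi} (\<lambda>R. eta 1 R * sin (R / 2))"
proof -
  obtain w\<^sub>1 where w1: "0 < w\<^sub>1" "w\<^sub>1 < 1" and pos: "\<And>w. 0 < w \<Longrightarrow> w < w\<^sub>1 \<Longrightarrow> g_fun 1 w > 0"
    and neg: "\<And>w. w\<^sub>1 < w \<Longrightarrow> w < 1 \<Longrightarrow> g_fun 1 w < 0"
    using g_1_sign_change by metis
  \<comment> \<open>The radius at which \<open>hw\<close> takes the value
    \<open>w\<^sub>1\<close>.\<close>
  define R\<^sub>1 where "R\<^sub>1 = 2 * arcsin (sqrt w\<^sub>1)"
  have s: "0 < sqrt w\<^sub>1" "sqrt w\<^sub>1 < 1" using w1 by auto
  have R1: "0 < R\<^sub>1" "R\<^sub>1 < pi" 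
    using arcsin_less_arcsin[of 0 "sqrt w\<^sub>1"] arcsin_less_arcsin[of "sqrt w\<^sub>1" 1] s by (auto simp: R\<^sub>1_def)
  have "sin (arcsin (sqrt w\<^sub>1)) = sqrt w\<^sub>1" using s by (intro sin_arcsin) linarith+
  then have hR1: "hw R\<^sub>1 = w\<^sub>1" unfolding hw_def R\<^sub>1_def using w1 by simp
  have d: "((\<lambda>w. (q_fun 1 w)\<^sup>2 * (1 - w)) has_real_derivative q_fun 1 x * g_fun 1 x) (at x)" "q_fun 1 x > 0"
    if "0 < x" "x < 1" for x
    using q_sq_has_derivative[of x 1] q_pos[of x 1] that by auto
  have "strict_antimono_on {0<..<R\<^sub>1} (\<lambda>R. eta 1 R * sin (R / 2))"
  proof (rule monotone_onI)
    fix R R' :: real assume R: "R \<in> {0<..<R\<^sub>1}" "R' \<in> {0<..<R\<^sub>1}" "R < R'"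
    show "eta 1 R' * sin (R' / 2) < eta 1 R * sin (R / 2)"
    proof (rule eta_sin_half_less, goal_cases)
      case 3
      show ?case
      proof (rule DERIV_pos_imp_increasing[where f = "\<lambda>w. (q_fun 1 w)\<^sup>2 * (1 - w)"])
        show "hw R < hw R'" using R R1 by (intro hw_strict_mono) auto
        fix x assume "hw R \<le> x" "x \<le> hw R'"
        then have x: "0 < x" "x < w\<^sub>1" using hw_bounds[of R] hw_strict_mono[of R' R\<^sub>1] R R1 hR1 by auto
        then show "\<exists>y. ((\<lambda>w. (q_fun 1 w)\<^sup>2 * (1 - w)) has_real_derivative y) (at x) \<and> y > 0"
          using d[of x] pos[of x] w1 by (auto intro!: exI[of _ "q_fun 1 x * g_fun 1 x"])
      qed
    qed (use R R1 in auto)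
  qed
  moreover have "strict_mono_on {R\<^sub>1<..<pi} (\<lambda>R. eta 1 R * sin (R / 2))"
  proof (rule monotone_onI)
    fix R R' :: real assume R: "R \<in> {R\<^sub>1<..<pi}" "R' \<in> {R\<^sub>1<..<pi}" "R < R'"
    show "eta 1 R * sin (R / 2) < eta 1 R' * sin (R' / 2)"
    proof (rule eta_sin_half_less, goal_cases)
      case 3
      show ?case
      proof (rule DERIV_neg_imp_decreasing[where f = "\<lambda>w. (q_fun 1 w)\<^sup>2 * (1 - w)"])
        show "hw R < hw R'" using R R1 by (intro hw_strict_mono) auto
        fix x assume "hw R \<le> x" "x \<le> hw R'"
        then have x: "w\<^sub>1 < x" "x < 1" using hw_bounds[of R'] hw_strict_mono[of R\<^sub>1 R] R R1 hR1 by auto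
        then show "\<exists>y. ((\<lambda>w. (q_fun 1 w)\<^sup>2 * (1 - w)) has_real_derivative y) (at x) \<and> y < 0"
          using d[of x] neg[of x] w1 by (auto intro!: exI[of _ "q_fun 1 x * g_fun 1 x"] simp: mult_pos_neg)
      qed
    qed (use R R1 in auto)
  qed
  ultimately show ?thesis using R1 by auto
qed

section \<open>Monotonicity of \<open>eta m R * R\<close>\<close>

lemma sin_less_self: assumes "0 < x" "x < pi" shows "sin x < (x::real)"
proof -
  have "0 - sin 0 < x - sin x"
  proof (rule DERIV_pos_imp_increasing_open[OF assms(1)])
    fix y :: real assume y: "0 < y" "y < x"
    have "cos y < cos 0" using y assms by (intro cos_monotone_0_pi) auto
    then show "\<exists>d. ((\<lambda>x. x - sin x) has_real_derivative d) (at y) \<and> d > 0"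
      by (intro exI[of _ "1 - cos y"]) (auto intro!: derivative_eq_intros)
  qed (intro continuous_intros)
  then show ?thesis by simp
qed

text \<open>The expression vanishes at 0, and its derivative factors as 2 sin y (m y - sin y), which
  is positive because sin y < y <= m y.\<close>

lemma sin_cos_bound:
  assumes m: "m \<ge> 1" and R: "0 < R" "R < pi"
  shows "sin R * cos R - R + 2 * real m * (sin R - R * cos R) > 0"
proof -
  let ?f = "\<lambda>R. sin R * cos R - R + 2 * real m * (sin R - R * cos R)"
  have "?f 0 < ?f R"
  proof (rule DERIV_pos_imp_increasing_open[OF R(1)])
    fix y :: real assume y: "0 < y" "y < R"
    have "sin y < 1 * y" using y R sin_less_self[of y] by simp
    also have "1 * y \<le> m * y" using m y by (intro mult_right_mono) auto
    finally have "2 * sin y * (m * y - sin y) > 0" using half_pos[of y] y R by simp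
    moreover have "(?f has_real_derivative 2 * sin y * (m * y - sin y)) (at y)"
      using sin_squared_eq[of y]
      by (auto intro!: derivative_eq_intros simp: algebra_simps power2_eq_square)
    ultimately show "\<exists>d. (?f has_real_derivative d) (at y) \<and> d > 0" by blast
  qed (intro continuous_intros)
  then show ?thesis by simp
qed

text \<open>By the differential equation, the derivative of \<open>eta m R * R\<close> is a positive
  multiple of \<open>q_fun m (hw R) * denom m R - 2 * R\<close>.\<close>

definition denom :: "nat \<Rightarrow> real \<Rightarrow> real" where
  "denom m R = sin R + R * cos R + 2 * real m * R"

lemma q_ode_polar:
  assumes R: "0 < R" "R < pi"
  shows "(m + cos R) * q_fun m (hw R) + (sin R)\<^sup>2 / 4 * q_deriv m (hw R) = 1"
proof -
  have s: "(sin R)\<^sup>2 / 4 = hw R * (1 - hw R)" unfolding hw_eqs(3) by simp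
  show ?thesis
    using q_ode[OF hw_bounds(4)[OF R], of m] unfolding s hw_eqs(2)[of R] by (simp add: algebra_simps)
qed

text \<open>Half of \<open>q_fun m (hw R)\<close> times the integrating factor of its equation in
  \<open>R\<close>, so that \<open>q_fun\<close> disappears from the derivative.\<close>

definition flux :: "nat \<Rightarrow> real \<Rightarrow> real" where
  "flux m R = tan (R / 2) ^ (2 * m) * (sin R)\<^sup>2 * q_fun m (hw R) / 2"

lemma flux_has_derivative:
  assumes R: "0 < R" "R < pi"
  shows "(flux m has_real_derivative tan (R / 2) ^ (2 * m) * sin R) (at R)"
proof -
  have s: "sin R > 0" using half_pos[OF R] by simp
  let ?T = "tan (R / 2) ^ (2 * m)" and ?q = "q_fun m (hw R)" and ?q' = "q_deriv m (hw R)"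
  have "(flux m has_real_derivative
      ((real (2 * m) * ?T / sin R * (sin R)\<^sup>2 + 2 * sin R * cos R * ?T) * ?q + ?q' * (sin R / 2) * (?T * (sin R)\<^sup>2)) / 2) (at R)"
    unfolding flux_def[abs_def]
    by (intro DERIV_cdivide DERIV_mult tan_half_has_derivative[OF R] q_hw_has_derivative R)
      (auto intro!: derivative_eq_intros)
  moreover have "((real (2 * m) * ?T / sin R * (sin R)\<^sup>2 + 2 * sin R * cos R * ?T) * ?q + ?q' * (sin R / 2) * (?T * (sin R)\<^sup>2)) / 2
      = ?T * sin R * ((m + cos R) * ?q + (sin R)\<^sup>2 / 4 * ?q')"
    using s by (simp add: field_simps power2_eq_square)
  moreover have "(m + cos R) * ?q + (sin R)\<^sup>2 / 4 * ?q' = 1"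
    by (rule q_ode_polar[OF R])
  ultimately show ?thesis by simp
qed

text \<open>\<open>R * cos R\<close> costs at most half of the term \<open>2 * real m * R\<close>.
  The bound makes the quotient in \<open>flux_gt\<close> legitimate and controls it near 0.\<close>

lemma denom_ge:
  assumes "m \<ge> 1" "0 < R" "R < pi" shows "denom m R \<ge> R"
proof -
  have "R * (-1) \<le> R * cos R" using assms by (intro mult_left_mono) auto
  moreover have "R * 1 \<le> R * m" using assms by (intro mult_left_mono) auto
  ultimately show ?thesis using half_pos[OF assms(2,3)] unfolding denom_def by (simp add: algebra_simps)
qed

text \<open>
  Both sides vanish at 0. The derivative of the left side is \<open>tan (R/2)^(2m) sin R\<close>, and that of the
  right side is smaller by \<open>sin_cos_bound\<close>.
\<close>

lemma flux_gt:
  assumes m: "m \<ge> 1" and R: "0 < R" "R < pi"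
  shows "flux m R > R * tan (R / 2) ^ (2 * m) * (sin R)\<^sup>2 / denom m R"
proof -
  define N :: "real \<Rightarrow> real" where "N R = R * (tan (R / 2) ^ (2 * m) * (sin R)\<^sup>2)" for R
  define h :: "real \<Rightarrow> real" where "h R = flux m R - N R / denom m R" for R
  have d: "\<exists>y. (h has_real_derivative y) (at x) \<and> y > 0" if x: "0 < x" "x < pi" for x
  proof -
    define T where "T = tan (x / 2) ^ (2 * m)"
    define D where "D = denom m x"
    define D' where "D' = 2 * cos x - x * sin x + 2 * real m"
    have s: "sin x > 0" using half_pos[OF x] by simp
    have T: "T > 0" using x by (auto simp: T_def intro!: zero_less_power tan_gt_zero)
    have D: "D > 0" using denom_ge[OF m x] x by (simp add: D_def)
    have dD: "(denom m has_real_derivative D') (at x)"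
      unfolding denom_def[abs_def] D'_def by (auto intro!: derivative_eq_intros)
    have "(N has_real_derivative 1 * (T * (sin x)\<^sup>2) + (real (2 * m) * T / sin x * (sin x)\<^sup>2 + 2 * sin x * cos x * T) * x) (at x)"
      unfolding N_def[abs_def] T_def
      by (intro DERIV_mult tan_half_has_derivative[OF x] DERIV_ident) (auto intro!: derivative_eq_intros)
    moreover have "1 * (T * (sin x)\<^sup>2) + (real (2 * m) * T / sin x * (sin x)\<^sup>2 + 2 * sin x * cos x * T) * x = T * sin x * (D + x * cos x)"
      using s by (simp add: D_def denom_def field_simps power2_eq_square)
    ultimately have dN: "(N has_real_derivative T * sin x * (D + x * cos x)) (at x)" by simp
    have "(h has_real_derivative T * sin x - (T * sin x * (D + x * cos x) * D - N x * D') / (D * D)) (at x)"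
      unfolding h_def[abs_def] D_def
      by (intro DERIV_diff DERIV_divide flux_has_derivative[OF x, of m, folded T_def] dN[unfolded D_def] dD)
        (use D in \<open>simp_all add: D_def\<close>)
    \<comment> \<open>The contributions T sin x of the two sides cancel; what remains has the sign
      of sin x D' - cos x D, the expression in \<open>sin_cos_bound\<close>.\<close>
    moreover have "T * sin x - (T * sin x * (D + x * cos x) * D - N x * D') / (D * D) =
        T * sin x * x * (sin x * D' - cos x * D) / (D * D)"
    proof -
      have "N x = x * (T * (sin x)\<^sup>2)" unfolding N_def T_def ..
      then show ?thesis using D by (simp add: field_simps power2_eq_square)
    qed
    moreover have "sin x * D' - cos x * D = sin x * cos x - x + 2 * real m * (sin x - x * cos x)"
    proof -
      have "x * (sin x * sin x + cos x * cos x) = x"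
        by (simp only: add.commute[of "sin x * sin x"] sin_cos_squared_add3 mult_1_right)
      then show ?thesis by (simp only: D'_def D_def denom_def) (simp add: algebra_simps del: sin_cos_squared_add3)
    qed
    moreover have "T * sin x * x * (sin x * cos x - x + 2 * real m * (sin x - x * cos x)) / (D * D) > 0"
      using sin_cos_bound[OF m x] T s x(1) D by (intro divide_pos_pos mult_pos_pos) auto
    ultimately show ?thesis by metis
  qed
  have mono: "h x < h y" if "0 < x" "x < y" "y < pi" for x y
    by (rule DERIV_pos_imp_increasing[OF that(2)]) (use d that in auto)
  \<comment> \<open>The quotient in \<open>h\<close> is 0 / 0 at the origin, so instead of a value
    there a lower bound that tends to 0 is used.\<close>
  have lower: "- (tan (x / 2) ^ (2 * m) * (sin x)\<^sup>2) \<le> h (R / 2)" if x: "0 < x" "x < R / 2" for x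
  proof -
    have x': "0 < x" "x < pi" using x R by auto
    let ?T = "tan (x / 2) ^ (2 * m) * (sin x)\<^sup>2"
    have T: "?T \<ge> 0" by (simp add: power_mult)
    have "x / denom m x \<le> 1" using denom_ge[OF m x'] x' by simp
    then have "x / denom m x * ?T \<le> 1 * ?T" by (intro mult_right_mono T)
    moreover have "flux m x \<ge> 0" using T q_hw_pos[OF x', of m] by (simp add: flux_def)
    ultimately have "- ?T \<le> h x" by (simp add: h_def N_def)
    also have "h x < h (R / 2)" using mono[of x "R / 2"] x R by simp
    finally show ?thesis by simp
  qed
  have "h (R / 2) \<ge> 0"
  proof (rule tendsto_upperbound)
    have "isCont (\<lambda>x. - (tan (x / 2) ^ (2 * m) * (sin x)\<^sup>2)) 0"
      by (intro continuous_intros) auto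
    then have "((\<lambda>x. - (tan (x / 2) ^ (2 * m) * (sin x)\<^sup>2)) \<longlongrightarrow> 0) (at 0)"
      by (simp add: isCont_def)
    then show "((\<lambda>x. - (tan (x / 2) ^ (2 * m) * (sin x)\<^sup>2)) \<longlongrightarrow> 0) (at_right 0)"
      by (rule tendsto_within_subset) simp
    show "eventually (\<lambda>x. - (tan (x / 2) ^ (2 * m) * (sin x)\<^sup>2) \<le> h (R / 2)) (at_right 0)"
      unfolding eventually_at_right_field using lower R by (intro exI[of _ "R / 2"]) auto
  qed simp
  \<comment> \<open>The limit gives only a weak inequality at \<open>R / 2\<close>; strictness comes
    from the passage to \<open>R\<close>.\<close>
  also have "h (R / 2) < h R" using mono[of "R / 2" R] R by simp
  finally show ?thesis by (simp add: h_def N_def mult.assoc)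
qed

lemma eta_id_increasing:
  assumes m: "m \<ge> 1" shows "strict_mono_on {0<..<pi} (\<lambda>R. eta m R * R)"
proof (rule monotone_onI)
  fix R R' :: real assume RR: "R \<in> {0<..<pi}" "R' \<in> {0<..<pi}" "R < R'"
  show "eta m R * R < eta m R' * R'"
  proof (rule DERIV_pos_imp_increasing[OF RR(3)])
    fix x assume "R \<le> x" "x \<le> R'"
    then have x: "0 < x" "x < pi" using RR by auto
    define q where "q = q_fun m (hw x)"
    define N where "N = q * sin x"
    define N' where "N' = q_deriv m (hw x) * (sin x / 2) * sin x + cos x * q"
    have s: "sin x > 0" using half_pos[OF x] by simp
    have q: "q > 0" using q_hw_pos[OF x] by (simp add: q_def)
    then have N: "N > 0" using s by (simp add: N_def)
    have dN: "((\<lambda>R. q_fun m (hw R) * sin R) has_real_derivative N') (at x)"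
      unfolding N'_def q_def by (intro DERIV_mult q_hw_has_derivative x DERIV_sin)
    have "((\<lambda>R. 2 / (q_fun m (hw R) * sin R) * R) has_real_derivative
        (0 * N - 2 * N') / (N * N) * x + 1 * (2 / N)) (at x)"
      unfolding N_def q_def
      by (intro DERIV_mult DERIV_divide DERIV_const dN DERIV_ident) (use q s in \<open>simp add: q_def\<close>)
    then have "((\<lambda>R. eta m R * R) has_real_derivative 2 * (N - x * N') / (N * N)) (at x)"
      unfolding eta_def by (rule DERIV_cong) (use N in \<open>simp add: field_simps\<close>)
    \<comment> \<open>The differential equation replaces \<open>q_deriv\<close>, so that only
      \<open>q\<close> itself has to be bounded from below.\<close>
    moreover have "N - x * N' = q * denom m x - 2 * x"
    proof -
      have "(m + cos x) * q + (sin x)\<^sup>2 / 4 * q_deriv m (hw x) = 1"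
        unfolding q_def by (rule q_ode_polar[OF x])
      then have "q_deriv m (hw x) * (sin x / 2) * sin x = 2 * (1 - (m + cos x) * q)"
        by (simp add: power2_eq_square field_simps)
      then have N': "N' = 2 * (1 - (m + cos x) * q) + cos x * q" unfolding N'_def by simp
      show ?thesis unfolding N_def N' denom_def by (simp add: algebra_simps)
    qed
    moreover have "q * denom m x - 2 * x > 0"
    proof -
      define T where "T = tan (x / 2) ^ (2 * m) * (sin x)\<^sup>2"
      have T: "T > 0" using x s by (auto simp: T_def intro!: mult_pos_pos zero_less_power tan_gt_zero)
      have D: "denom m x > 0" using denom_ge[OF m x] x by simp
      have "T * q / 2 > x * T / denom m x"
        using flux_gt[OF m x] by (simp add: flux_def T_def q_def mult.assoc)
      then have "x * T * 2 < T * q * denom m x" using D by (simp add: field_simps)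
      then have "T * (2 * x) < T * (q * denom m x)" by (simp add: mult_ac)
      then show ?thesis using T by simp
    qed
    ultimately show "\<exists>y. ((\<lambda>R. eta m R * R) has_real_derivative y) (at x) \<and> y > 0"
      using N by (intro exI[of _ "2 * (N - x * N') / (N * N)"]) simp
  qed
qed

section \<open>The Steklov spectrum of the disk\<close>

text \<open>\<open>\<kappa> = 0\<close> gives the particular solution for
  \<open>steklov_mode_vanishes\<close>; \<open>\<kappa> = k_fun m (hw R)\<close> makes the function
  vanish on the boundary.\<close>

definition radial :: "nat \<Rightarrow> real \<Rightarrow> real \<Rightarrow> real" where
  "radial m \<kappa> r = tan (r / 2) ^ m * (k_fun m (hw r) - \<kappa>)"

text \<open>\<open>sin r\<close> times the derivative of \<open>radial m \<kappa>\<close>, in a form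
  that is continuous at \<open>r = 0\<close>.\<close>

definition radial_flux :: "nat \<Rightarrow> real \<Rightarrow> real \<Rightarrow> real" where
  "radial_flux m \<kappa> r = m * radial m \<kappa> r + tan (r / 2) ^ m * (sin r)\<^sup>2 * q_fun m (hw r) / 2"

lemma radial_has_derivative:
  assumes r: "0 < r" "r < pi"
  shows "(radial m \<kappa> has_real_derivative radial_flux m \<kappa> r / sin r) (at r)"
    and "(radial_flux m \<kappa> has_real_derivative (real m)\<^sup>2 * radial m \<kappa> r / sin r + sin r * tan (r / 2) ^ m) (at r)"
proof -
  have s: "sin r > 0" using half_pos[OF r] by simp
  let ?T = "tan (r / 2) ^ m" and ?q = "q_fun m (hw r)" and ?q' = "q_deriv m (hw r)"
  have k: "((\<lambda>r. k_fun m (hw r) - \<kappa>) has_real_derivative ?q * (sin r / 2) - 0) (at r)"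
    by (intro DERIV_diff DERIV_const DERIV_chain2[OF k_has_derivative hw_has_derivative] hw_bounds r)
  have "(radial m \<kappa> has_real_derivative
      m * ?T / sin r * (k_fun m (hw r) - \<kappa>) + (?q * (sin r / 2) - 0) * ?T) (at r)"
    unfolding radial_def[abs_def] by (intro DERIV_mult tan_half_has_derivative[OF r] k)
  moreover have "m * ?T / sin r * (k_fun m (hw r) - \<kappa>) + (?q * (sin r / 2) - 0) * ?T = radial_flux m \<kappa> r / sin r"
    using s by (simp add: radial_flux_def radial_def field_simps power2_eq_square)
  ultimately show d: "(radial m \<kappa> has_real_derivative radial_flux m \<kappa> r / sin r) (at r)" by simp
  have "(radial_flux m \<kappa> has_real_derivative m * (radial_flux m \<kappa> r / sin r) +
      ((m * ?T / sin r * (sin r)\<^sup>2 + 2 * sin r * cos r * ?T) * ?q + ?q' * (sin r / 2) * (?T * (sin r)\<^sup>2)) / 2) (at r)"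
    unfolding radial_flux_def[abs_def]
    by (intro DERIV_add DERIV_cmult d[unfolded radial_flux_def] DERIV_cdivide DERIV_mult tan_half_has_derivative[OF r] q_hw_has_derivative r)
      (auto intro!: derivative_eq_intros)
  moreover have "m * (radial_flux m \<kappa> r / sin r) +
      ((m * ?T / sin r * (sin r)\<^sup>2 + 2 * sin r * cos r * ?T) * ?q + ?q' * (sin r / 2) * (?T * (sin r)\<^sup>2)) / 2 =
      (real m)\<^sup>2 * radial m \<kappa> r / sin r + sin r * ?T * ((m + cos r) * ?q + (sin r)\<^sup>2 / 4 * ?q')"
    using s by (simp add: radial_flux_def field_simps power2_eq_square)
  ultimately show "(radial_flux m \<kappa> has_real_derivative (real m)\<^sup>2 * radial m \<kappa> r / sin r + sin r * tan (r / 2) ^ m) (at r)"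
    using q_ode_polar[OF r, of m] by simp
qed

lemma radial_continuous:
  assumes R: "R < pi"
  shows "continuous_on {0..R} (radial m \<kappa>)" "continuous_on {0..R} (radial_flux m \<kappa>)" "radial_flux m \<kappa> 0 = 0"
proof -
  have tan_cont: "continuous_on {0..R} (\<lambda>r. tan (r / 2))"
    by (intro continuous_intros ballI less_imp_neq[THEN not_sym] cos_gt_zero_pi) (use R in auto)
  have hw: "continuous_on {0..R} hw" unfolding hw_def[abs_def] by (intro continuous_intros) auto
  have b: "\<bar>hw r\<bar> < 1" if "r \<in> {0..R}" for r
    using that R hw_bounds(4)[of r] by (cases "r = 0") (auto simp: hw_def)
  have "isCont (k_fun m) w" "isCont (q_fun m) w" if "\<bar>w\<bar> < 1" for w
    using DERIV_isCont[OF k_has_derivative[OF that]] DERIV_isCont[OF q_has_derivative[OF that]] .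
  then have "continuous_on (hw ` {0..R}) (k_fun m)" "continuous_on (hw ` {0..R}) (q_fun m)"
    using b by (auto intro!: continuous_at_imp_continuous_on)
  then have "continuous_on {0..R} (\<lambda>r. k_fun m (hw r))" "continuous_on {0..R} (\<lambda>r. q_fun m (hw r))"
    using continuous_on_compose[OF hw] by (simp_all add: o_def)
  then show "continuous_on {0..R} (radial m \<kappa>)" "continuous_on {0..R} (radial_flux m \<kappa>)"
    unfolding radial_def[abs_def] radial_flux_def[abs_def]
    by (intro continuous_intros tan_cont; simp)+
  show "radial_flux m \<kappa> 0 = 0" by (cases m) (simp_all add: radial_flux_def radial_def)
qed

section \<open>Smooth eigenfunctions on the disk\<close>

context polar_frame
begin

text \<open>Real and imaginary parts of (x + i y)^m with x, y the coordinates of \<open>p\<close>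
  along \<open>e1\<close>, \<open>e2\<close>: polynomials in \<open>p\<close>, hence smooth at the
  pole, where the angle is not.\<close>

fun harm :: "nat \<Rightarrow> real^3 \<Rightarrow> real" and harm' :: "nat \<Rightarrow> real^3 \<Rightarrow> real" where
  "harm 0 p = 1"
| "harm' 0 p = 0"
| "harm (Suc m) p = (e1 \<bullet> p) * harm m p - (e2 \<bullet> p) * harm' m p"
| "harm' (Suc m) p = (e1 \<bullet> p) * harm' m p + (e2 \<bullet> p) * harm m p"

lemma harm_pol: "harm m (pol r \<theta>) = sin r ^ m * cos (real m * \<theta>)" "harm' m (pol r \<theta>) = sin r ^ m * sin (real m * \<theta>)"
  by (induction m) (simp_all add: pol_inner ring_distribs cos_add sin_add)

lemma Ck_on_harm: assumes "open U" shows "Ck_on k U (harm m)" "Ck_on k U (harm' m)"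
proof (induction m)
  case 0
  have "harm 0 = (\<lambda>p. 1)" "harm' 0 = (\<lambda>p. 0)" by (simp_all add: fun_eq_iff)
  then show "Ck_on k U (harm 0)" "Ck_on k U (harm' 0)" by (simp_all add: Ck_on_const[OF assms])
next
  case (Suc m)
  have "harm (Suc m) = (\<lambda>p. (e1 \<bullet> p) * harm m p - (e2 \<bullet> p) * harm' m p)"
    "harm' (Suc m) = (\<lambda>p. (e1 \<bullet> p) * harm' m p + (e2 \<bullet> p) * harm m p)"
    by (simp_all add: fun_eq_iff)
  then show "Ck_on k U (harm (Suc m))" "Ck_on k U (harm' (Suc m))"
    by (auto intro!: Ck_on_add Ck_on_diff Ck_on_mult Ck_on_inner Suc assms)
qed

text \<open>
  In polar coordinates \<open>harm m\<close> is \<open>sin r ^ m * cos (m \<theta>)\<close>, and \<open>sin r / (1 + cos r) = tan (r/2)\<close>;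
  this makes the eigenfunction smooth across the pole \<open>c\<close>.
\<close>

definition eigenfun :: "nat \<Rightarrow> real \<Rightarrow> real^3 \<Rightarrow> real" where
  "eigenfun m \<kappa> p = harm m p * inverse (1 + c \<bullet> p) ^ m * (k_fun m ((1 - c \<bullet> p) / 2) - \<kappa>)"

text \<open>The lower bound keeps \<open>1 + c \<bullet> p\<close> invertible and
  \<open>(1 - c \<bullet> p) / 2\<close> below 1, the upper one keeps the latter above -1, inside
  the interval of convergence. The set is open in space, as \<open>smooth_near\<close>
  demands.\<close>

definition slab :: "(real^3) set" where "slab = {p. -1 < c \<bullet> p} \<inter> {p. c \<bullet> p < 3}"

lemma open_slab: "open slab"
  unfolding slab_def by (intro open_Int open_halfspace_gt open_halfspace_lt)

lemma pol_in_slab: "0 \<le> r \<Longrightarrow> r < pi \<Longrightarrow> pol r \<theta> \<in> slab"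
  using cos_monotone_0_pi[of r pi] cos_le_one[of r] unfolding slab_def
  by (auto simp: pol_inner simp del: cos_le_one)

lemma Ck_on_eigenfun: "Ck_on k slab (eigenfun m \<kappa>)"
proof -
  note const = Ck_on_const[OF open_slab] and inner = Ck_on_inner[OF open_slab]
  have "Ck_on k slab (\<lambda>p. (1 - c \<bullet> p) * (1 / 2))"
    by (rule Ck_on_mult[OF open_slab Ck_on_diff[OF open_slab const inner] const])
  then have g: "Ck_on k slab (\<lambda>p. (1 - c \<bullet> p) / 2)" by simp
  have "(\<lambda>p. (1 - c \<bullet> p) / 2) ` slab \<subseteq> {-1<..<1}" by (auto simp: slab_def)
  moreover have "(pow_ser (k_coeff m) n has_real_derivative pow_ser (k_coeff m) (Suc n) x) (at x)"
    if "x \<in> {-1<..<1}" for n x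
    using that by (intro pow_ser(2) abs_k_coeff) auto
  ultimately have k: "Ck_on k slab (\<lambda>p. k_fun m ((1 - c \<bullet> p) / 2))"
    unfolding k_fun_def by (rule Ck_on_compose_real[OF open_slab g open_greaterThanLessThan])
  have i: "Ck_on k slab (\<lambda>p. inverse (1 + c \<bullet> p))"
  proof (rule Ck_on_inverse[OF open_slab Ck_on_add[OF open_slab const inner]])
    fix p assume "p \<in> slab"
    then have "-1 < c \<bullet> p" by (simp add: slab_def)
    then show "1 + c \<bullet> p \<noteq> 0" by linarith
  qed
  show ?thesis unfolding eigenfun_def[abs_def]
    by (rule Ck_on_mult[OF open_slab Ck_on_mult[OF open_slab Ck_on_harm(1)[OF open_slab]
            Ck_on_power[OF open_slab i]] Ck_on_diff[OF open_slab k const]])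
qed

lemma eigenfun_pol:
  assumes "0 \<le> r" "r < pi" shows "eigenfun m \<kappa> (pol r \<theta>) = radial m \<kappa> r * cos (real m * \<theta>)"
proof -
  have "tan (r / 2) = sin r / (cos r + 1)" using tan_half[of "r / 2"] by simp
  then have "tan (r / 2) = sin r * inverse (1 + cos r)" by (simp only: divide_inverse add.commute)
  moreover have "(1 - cos r) / 2 = hw r" using hw_eqs(2)[of r] by simp
  ultimately show ?thesis
    by (simp add: eigenfun_def harm_pol pol_inner radial_def power_mult_distrib)
qed

text \<open>Reads the Laplacian off a solution of the first-order system. It serves both for the
  eigenfunction and, with zero source \<open>b\<close>, for its Laplacian; the poles are excluded
  because \<open>sin r\<close> is cancelled.\<close>

lemma laplacian_mode:
  assumes U: "open U" and f: "Ck_on (Suc (Suc 0)) U f"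
    and in_U: "\<And>r \<theta>. 0 < r \<Longrightarrow> r < pi \<Longrightarrow> pol r \<theta> \<in> U"
    and eq: "\<And>r \<theta>. 0 < r \<Longrightarrow> r < pi \<Longrightarrow> f (pol r \<theta>) = a r * cos (real m * \<theta>)"
    and a: "\<And>r. 0 < r \<Longrightarrow> r < pi \<Longrightarrow> (a has_real_derivative s r / sin r) (at r)"
    and s: "\<And>r. 0 < r \<Longrightarrow> r < pi \<Longrightarrow> (s has_real_derivative (real m)\<^sup>2 * a r / sin r + sin r * b r) (at r)"
    and r: "0 < r" "r < pi"
  shows "f_r f r \<theta> = s r / sin r * cos (real m * \<theta>)"
    and "sphere_laplacian f (pol r \<theta>) = b r * cos (real m * \<theta>)"
proof -
  let ?s' = "\<lambda>r. (real m)\<^sup>2 * a r / sin r + sin r * b r"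
  have a': "((\<lambda>r. s r / sin r) has_real_derivative (?s' r * sin r - s r * cos r) / (sin r * sin r)) (at r)"
    if "0 < r" "r < pi" for r
    using half_pos[OF that] by (intro DERIV_divide s that DERIV_sin) auto
  have sr: "sin r > 0" using half_pos[OF r] by simp
  have c1: "((\<lambda>\<theta>. cos (real m * \<theta>)) has_real_derivative - (m * sin (real m * \<theta>))) (at \<theta>)" for \<theta>
    by (auto intro!: derivative_eq_intros)
  have c2: "((\<lambda>\<theta>. - (m * sin (real m * \<theta>))) has_real_derivative - ((real m)\<^sup>2 * cos (real m * \<theta>))) (at \<theta>)" for \<theta>
    by (auto intro!: derivative_eq_intros simp: power2_eq_square)
  note L = polar_laplacianI[OF U f open_greaterThanLessThan[of 0 pi] _ _ _ _ c1 c2,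
      of a "\<lambda>r. s r / sin r" "\<lambda>r. (?s' r * sin r - s r * cos r) / (sin r * sin r)" r \<theta>]
  show "f_r f r \<theta> = s r / sin r * cos (real m * \<theta>)"
    by (rule L(1)) (use in_U eq a a' r in auto)
  have "(sin r)\<^sup>2 * sphere_laplacian f (pol r \<theta>) =
      ((sin r)\<^sup>2 * ((?s' r * sin r - s r * cos r) / (sin r * sin r)) + sin r * cos r * (s r / sin r)) * cos (real m * \<theta>)
      + a r * - ((real m)\<^sup>2 * cos (real m * \<theta>))"
    by (rule L(2)) (use in_U eq a a' r in auto)
  also have "(sin r)\<^sup>2 * ((?s' r * sin r - s r * cos r) / (sin r * sin r)) + sin r * cos r * (s r / sin r) = ?s' r * sin r"
    using sr by (simp add: power2_eq_square)
  also have "?s' r * sin r = (real m)\<^sup>2 * a r + (sin r)\<^sup>2 * b r"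
    using sr by (simp add: field_simps power2_eq_square)
  finally have "(sin r)\<^sup>2 * sphere_laplacian f (pol r \<theta>) = (sin r)\<^sup>2 * (b r * cos (real m * \<theta>))"
    by (simp add: algebra_simps)
  then show "sphere_laplacian f (pol r \<theta>) = b r * cos (real m * \<theta>)" using sr by simp
qed

lemma eigenfun_laplacian:
  assumes r: "0 < r" "r < pi"
  shows "f_r (eigenfun m \<kappa>) r \<theta> = radial_flux m \<kappa> r / sin r * cos (real m * \<theta>)"
    and "sphere_laplacian (eigenfun m \<kappa>) (pol r \<theta>) = tan (r / 2) ^ m * cos (real m * \<theta>)"
  by (rule laplacian_mode[OF open_slab Ck_on_eigenfun pol_in_slab eigenfun_pol radial_has_derivative r]; simp)+

text \<open>Away from the pole the Laplacian of the eigenfunction has radial factor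
  \<open>tan (r / 2) ^ m\<close>, flux \<open>m * tan (r / 2) ^ m\<close> and zero source; the pole
  follows by continuity.\<close>

lemma eigenfun_biharmonic:
  assumes r: "0 \<le> r" "r < pi"
  shows "sphere_laplacian (sphere_laplacian (eigenfun m \<kappa>)) (pol r \<theta>) = 0"
proof -
  let ?v = "sphere_laplacian (eigenfun m \<kappa>)"
  have v: "Ck_on (Suc (Suc 0)) slab ?v"
    by (rule Ck_on_sphere_laplacian[OF open_slab Ck_on_eigenfun])
  have pos: "sphere_laplacian ?v (pol r \<theta>) = 0" if "0 < r" "r < pi" for r \<theta>
  proof -
    have "sphere_laplacian ?v (pol r \<theta>) = 0 * cos (real m * \<theta>)"
    proof (rule laplacian_mode(2)[OF open_slab v pol_in_slab eigenfun_laplacian(2) tan_half_has_derivative _ that])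
      fix x :: real assume x: "0 < x" "x < pi"
      show "((\<lambda>r. m * tan (r / 2) ^ m) has_real_derivative (real m)\<^sup>2 * tan (x / 2) ^ m / sin x + sin x * 0) (at x)"
        using DERIV_cmult[OF tan_half_has_derivative[OF x, of m], of "real m"] by (simp add: power2_eq_square mult.assoc)
    qed simp_all
    then show ?thesis by simp
  qed
  show ?thesis
  proof (cases "r = 0")
    case True
    have "continuous_on slab (sphere_laplacian ?v)"
      by (rule Ck_on_continuous[OF Ck_on_sphere_laplacian[OF open_slab v]])
    then have "continuous_on {0..1} (\<lambda>r. sphere_laplacian ?v (pol r \<theta>))"
      by (rule continuous_on_compose2)
        (use pol_in_slab pi_gt3 in \<open>auto simp: pol_def intro!: continuous_intros\<close>)
    then have "continuous_on (closure {0<..1}) (\<lambda>r. sphere_laplacian ?v (pol r \<theta>))" by simp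
    then have "sphere_laplacian ?v (pol 0 \<theta>) = 0"
      by (rule continuous_constant_on_closure) (use pos pi_gt3 in auto)
    then show ?thesis using True by simp
  qed (use pos r in auto)
qed

section \<open>Identification of the spectrum\<close>

lemma geodesic_disk_polar:
  assumes "0 < R" "R < pi"
  shows "p \<in> geodesic_disk c R \<longleftrightarrow> (\<exists>r\<in>{0..R}. \<exists>\<theta>. p = pol r \<theta>)"
    and "p \<in> geodesic_circle c R \<longleftrightarrow> (\<exists>\<theta>. p = pol R \<theta>)"
proof -
  have n: "norm (pol r \<theta>) = 1" for r \<theta> by (simp add: norm_eq_1 pol_inner)
  have a: "arccos (c \<bullet> pol r \<theta>) = r" if "r \<in> {0..R}" for r \<theta>
    using that assms by (simp add: pol_inner arccos_cos)
  have ex: "\<exists>\<theta>. p = pol r \<theta> \<and> 0 \<le> r" if "norm p = 1" "arccos (c \<bullet> p) = r" for r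
  proof -
    have pp: "p \<bullet> p = 1" using that by (simp add: norm_eq_1)
    have "\<bar>c \<bullet> p\<bar> \<le> 1"
      using Cauchy_Schwarz_ineq2[of c p] that on(1) by (simp add: norm_eq_1[symmetric])
    then have "0 \<le> arccos (c \<bullet> p)" by (intro arccos_lbound) auto
    moreover obtain \<theta> where "p = pol (arccos (c \<bullet> p)) \<theta>" by (rule sphere_polar[OF pp])
    ultimately show ?thesis unfolding that(2) by blast
  qed
  show "p \<in> geodesic_disk c R \<longleftrightarrow> (\<exists>r\<in>{0..R}. \<exists>\<theta>. p = pol r \<theta>)"
  proof
    assume p: "p \<in> geodesic_disk c R"
    then have "norm p = 1" "arccos (c \<bullet> p) \<le> R" by (simp_all add: geodesic_disk_def)
    then show "\<exists>r\<in>{0..R}. \<exists>\<theta>. p = pol r \<theta>"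
      using ex[OF _ refl] by (meson atLeastAtMost_iff)
  qed (auto simp: geodesic_disk_def n a)
  show "p \<in> geodesic_circle c R \<longleftrightarrow> (\<exists>\<theta>. p = pol R \<theta>)"
  proof
    assume p: "p \<in> geodesic_circle c R"
    then have "norm p = 1" "arccos (c \<bullet> p) = R" by (simp_all add: geodesic_circle_def)
    then show "\<exists>\<theta>. p = pol R \<theta>" using ex by blast
  qed (use a[of R] n assms in \<open>auto simp: geodesic_circle_def\<close>)
qed

lemma eta_is_eigenvalue:
  assumes R: "0 < R" "R < pi" shows "steklov_eigenvalue c R (eta m R)"
proof -
  define \<kappa> where "\<kappa> = k_fun m (hw R)"
  let ?u = "eigenfun m \<kappa>"
  note disk = geodesic_disk_polar[OF R]
  have s: "sin R > 0" using half_pos[OF R] by simp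
  have "smooth_near (geodesic_disk c R) ?u"
    unfolding smooth_near_def
    by (rule exI[of _ slab]) (use open_slab Ck_on_eigenfun pol_in_slab R in \<open>auto simp: disk\<close>)
  moreover have "\<exists>p\<in>geodesic_disk c R. ?u p \<noteq> 0"
  proof
    \<comment> \<open>At angle 0 the cosine is 1, and at half the radius \<open>k_fun m\<close>
      differs from its boundary value because its derivative \<open>q_fun m\<close> is
      positive.\<close>
    show "pol (R / 2) 0 \<in> geodesic_disk c R" unfolding disk using R by (intro bexI exI) auto
    have "hw (R / 2) < hw R" using R by (intro hw_strict_mono) auto
    then have "k_fun m (hw (R / 2)) < k_fun m (hw R)"
    proof (rule DERIV_pos_imp_increasing)
      fix x assume "hw (R / 2) \<le> x" "x \<le> hw R"
      then have "0 \<le> x" "x < 1" using hw_bounds[of "R / 2"] hw_bounds[OF R] R by auto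
      then show "\<exists>y. (k_fun m has_real_derivative y) (at x) \<and> 0 < y"
        by (intro exI[of _ "q_fun m x"] conjI k_has_derivative q_pos) auto
    qed
    moreover have "tan (R / 2 / 2) > 0" using R by (intro tan_gt_zero) auto
    ultimately show "?u (pol (R / 2) 0) \<noteq> 0"
      using R by (simp add: eigenfun_pol radial_def \<kappa>_def)
  qed
  moreover have "\<forall>p\<in>geodesic_disk c R. sphere_laplacian (sphere_laplacian ?u) p = 0"
    using eigenfun_biharmonic R by (auto simp: disk)
  moreover have "?u (pol R \<theta>) = 0 \<and> sphere_laplacian ?u (pol R \<theta>) =
      eta m R * frechet_derivative ?u (at (pol R \<theta>)) (disk_normal c R (pol R \<theta>))" for \<theta>
  proof
    \<comment> \<open>On the boundary only the \<open>q_fun\<close> term of the flux survives, which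
      produces the value of \<open>eta\<close>.\<close>
    have z: "radial m \<kappa> R = 0" by (simp add: radial_def \<kappa>_def)
    then show "?u (pol R \<theta>) = 0" using R by (simp add: eigenfun_pol)
    have "frechet_derivative ?u (at (pol R \<theta>)) (disk_normal c R (pol R \<theta>)) = f_r ?u R \<theta>"
      using s by (simp add: disk_normal_pol f_r_def)
    also have "\<dots> = tan (R / 2) ^ m * sin R * q_fun m (hw R) / 2 * cos (real m * \<theta>)"
      using s by (simp add: eigenfun_laplacian(1)[OF R] radial_flux_def z power2_eq_square)
    finally have fd: "frechet_derivative ?u (at (pol R \<theta>)) (disk_normal c R (pol R \<theta>)) =
        tan (R / 2) ^ m * sin R * q_fun m (hw R) / 2 * cos (real m * \<theta>)" .
    show "sphere_laplacian ?u (pol R \<theta>) =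
        eta m R * frechet_derivative ?u (at (pol R \<theta>)) (disk_normal c R (pol R \<theta>))"
      unfolding fd eigenfun_laplacian(2)[OF R] eta_def using s q_hw_pos[OF R, of m] by simp
  qed
  ultimately show ?thesis
    unfolding steklov_eigenvalue_def by (intro exI[of _ ?u]) (auto simp: disk)
qed

lemma eigenvalue_is_eta:
  assumes R: "0 < R" "R < pi" and ev: "steklov_eigenvalue c R \<eta>"
  shows "\<exists>m. \<eta> = eta m R"
proof (rule ccontr)
  assume ne: "\<nexists>m. \<eta> = eta m R"
  note disk = geodesic_disk_polar[OF R]
  have s: "sin R > 0" using half_pos[OF R] by simp
  obtain u where sm: "smooth_near (geodesic_disk c R) u" and nz: "\<exists>p\<in>geodesic_disk c R. u p \<noteq> 0"
    and bi: "\<forall>p\<in>geodesic_disk c R. sphere_laplacian (sphere_laplacian u) p = 0"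
    and bd: "\<forall>p\<in>geodesic_circle c R. u p = 0 \<and>
      sphere_laplacian u p = \<eta> * frechet_derivative u (at p) (disk_normal c R p)"
    using ev unfolding steklov_eigenvalue_def by blast
  obtain U where U: "open U" "geodesic_disk c R \<subseteq> U" "\<And>k. Ck_on k U u"
    using sm unfolding smooth_near_def by blast
  have in_disk: "pol r \<theta> \<in> geodesic_disk c R" if "r \<in> {0..R}" for r \<theta> using that disk by blast
  then have in_U: "case_prod pol ` ({0..R} \<times> UNIV) \<subseteq> U" using U(2) by auto
  have biharm: "sphere_laplacian (sphere_laplacian u) (pol r \<theta>) = 0" if "r \<in> {0..R}" for r \<theta>
    using bi in_disk[OF that] by blast
  have circ: "pol R \<theta> \<in> geodesic_circle c R" for \<theta> using disk by blast
  have bdry: "u (pol R \<theta>) = 0" "sphere_laplacian u (pol R \<theta>) = \<eta> * f_r u R \<theta>" for \<theta>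
    using bd circ[of \<theta>] s by (auto simp: f_r_def disk_normal_pol)
  \<comment> \<open>The difference in parentheses is tan(R/2)^m sin^2(R) q / 2, so equality would
    mean \<open>\<eta> = eta m R\<close>.\<close>
  have \<eta>: "\<eta> * (radial_flux m 0 R - m * radial m 0 R) \<noteq> tan (R / 2) ^ m * sin R" for m
  proof
    assume "\<eta> * (radial_flux m 0 R - m * radial m 0 R) = tan (R / 2) ^ m * sin R"
    moreover have "tan (R / 2) > 0" using R by (intro tan_gt_zero) auto
    ultimately have "\<eta> * (q_fun m (hw R) * sin R) = 2"
      using s by (simp add: radial_flux_def power2_eq_square mult_ac)
    then have "\<eta> = eta m R" using s q_hw_pos[OF R, of m] by (simp add: eta_def field_simps)
    then show False using ne by blast
  qed
  note vanish = steklov_mode_vanishes[OF U(1) U(3) R in_U biharm bdry _ _ _ _ radial_continuous[OF R(2)]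
      radial_has_derivative[OF _ less_trans[OF _ R(2)]] \<eta>]
  have cos0: "integral {0..2*pi} (\<lambda>\<theta>. u (pol r \<theta>) * cos (real m * \<theta>)) = 0" if "0 < r" "r \<le> R" for r m
    by (rule vanish[of "\<lambda>\<theta>. cos (real m * \<theta>)" "\<lambda>\<theta>. - (m * sin (real m * \<theta>))" m])
      (use that sin_2npi[of m] cos_2npi[of m] in \<open>auto intro!: derivative_eq_intros simp: power2_eq_square mult_ac\<close>)
  have sin0: "integral {0..2*pi} (\<lambda>\<theta>. u (pol r \<theta>) * sin (real m * \<theta>)) = 0" if "0 < r" "r \<le> R" for r m
    by (rule vanish[of "\<lambda>\<theta>. sin (real m * \<theta>)" "\<lambda>\<theta>. m * cos (real m * \<theta>)" m])
      (use that sin_2npi[of m] cos_2npi[of m] in \<open>auto intro!: derivative_eq_intros simp: power2_eq_square mult_ac\<close>)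
  have zero: "u (pol r \<theta>) = 0" if "0 < r" "r \<le> R" for r \<theta>
    by (rule circle_modes_vanish[OF U(1) Ck_on_continuous[OF U(3)] _ cos0[OF that] sin0[OF that]])
      (use in_disk[of r] U(2) that in auto)
  \<comment> \<open>The vanishing of the modes is available for \<open>0 < r\<close>; the centre is
    reached by continuity.\<close>
  have center: "u (pol 0 \<theta>) = 0" for \<theta>
  proof -
    have "continuous_on {0..R} (\<lambda>r. u (pol r \<theta>))"
      by (rule continuous_on_compose2[OF Ck_on_continuous[OF U(3)]])
        (use in_disk U(2) in \<open>auto simp: pol_def intro!: continuous_intros\<close>)
    then have "continuous_on (closure {0<..R}) (\<lambda>r. u (pol r \<theta>))" using R by simp
    then show ?thesis
      by (rule continuous_constant_on_closure) (use zero R in auto)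
  qed
  obtain p where p: "p \<in> geodesic_disk c R" "u p \<noteq> 0" using nz by blast
  obtain r \<theta> where "r \<in> {0..R}" "p = pol r \<theta>" using p(1) disk(1) by blast
  then show False using p(2) zero[of r \<theta>] center[of \<theta>] by (cases "r = 0") auto
qed

end

text \<open>The spectrum is the range of a strictly increasing sequence, so each LEAST is attained
  and the recursion picks the terms of the sequence one by one.\<close>

lemma steklov_eta_eq:
  assumes c: "norm c = 1" and R: "0 < R" "R < pi"
  shows "steklov_eta c m R = eta m R"
proof -
  obtain e1 e2 where "polar_frame c e1 e2" using polar_frame_exists[OF c] .
  then interpret polar_frame c e1 e2 .
  have ev: "steklov_eigenvalue c R \<eta> \<longleftrightarrow> (\<exists>m. \<eta> = eta m R)" for \<eta>
    using eta_is_eigenvalue[OF R] eigenvalue_is_eta[OF R] by blast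
  have mono: "strict_mono (\<lambda>m. eta m R)" by (rule strict_mono_Suc_iff[THEN iffD2]) (use eta_Suc[OF R] in blast)
  show ?thesis
  proof (induction m)
    case 0
    show ?case unfolding steklov_eta.simps
      by (rule Least_equality) (use ev strict_mono_less_eq[OF mono] in auto)
  next
    case (Suc m)
    show ?case unfolding steklov_eta.simps Suc
      by (rule Least_equality)
        (use ev strict_mono_less_eq[OF mono] strict_mono_less[OF mono] in \<open>auto simp: Suc_le_eq\<close>)
  qed
qed

theorem theorem5:
  fixes c :: "real^3" and m :: nat
  assumes "norm c = 1" and "m \<ge> 1"
  shows "strict_mono_on {0<..<pi} (\<lambda>R. steklov_eta c m R * R)
    \<and> strict_antimono_on {0<..<pi} (\<lambda>R. steklov_eta c m R * sin R)
    \<and> strict_mono_on {0<..<pi} (\<lambda>R. steklov_eta c m R * tan (R / 2))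
    \<and> (m = 1 \<longrightarrow> (\<exists>R\<^sub>1\<in>{0<..<pi}.
          strict_antimono_on {0<..<R\<^sub>1} (\<lambda>R. steklov_eta c m R * sin (R / 2)) \<and>
          strict_mono_on {R\<^sub>1<..<pi} (\<lambda>R. steklov_eta c m R * sin (R / 2))))
    \<and> (m \<ge> 2 \<longrightarrow> strict_mono_on {0<..<pi} (\<lambda>R. steklov_eta c m R * sin (R / 2)))"
proof -
  have eq: "steklov_eta c m R = eta m R" if "R \<in> {0<..<pi}" for R
    using steklov_eta_eq[OF assms(1)] that by simp
  \<comment> \<open>\<open>steklov_eta\<close> is identified with \<open>eta\<close> only for radii
    between 0 and pi, so monotonicity is transferred on subsets of that interval; \<open>ord\<close>
    covers both directions.\<close>
  have cong: "monotone_on A (<) ord (\<lambda>R. steklov_eta c m R * g R)"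
    if "A \<subseteq> {0<..<pi}" "monotone_on A (<) ord (\<lambda>R. eta m R * g R)"
    for A :: "real set" and ord and g :: "real \<Rightarrow> real"
    unfolding monotone_on_def
  proof (intro ballI impI)
    fix x y assume xy: "x \<in> A" "y \<in> A" "x < y"
    have "ord (eta m x * g x) (eta m y * g y)" by (rule monotone_onD[OF that(2) xy])
    then show "ord (steklov_eta c m x * g x) (steklov_eta c m y * g y)"
      using eq[of x] eq[of y] that(1) xy by (simp add: subset_iff)
  qed
  have "\<exists>R\<^sub>1\<in>{0<..<pi}.
      strict_antimono_on {0<..<R\<^sub>1} (\<lambda>R. steklov_eta c m R * sin (R / 2)) \<and>
      strict_mono_on {R\<^sub>1<..<pi} (\<lambda>R. steklov_eta c m R * sin (R / 2))" if m1: "m = 1"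
  proof -
    obtain R\<^sub>1 where R\<^sub>1: "R\<^sub>1 \<in> {0<..<pi}"
      "strict_antimono_on {0<..<R\<^sub>1} (\<lambda>R. eta m R * sin (R / 2))"
      "strict_mono_on {R\<^sub>1<..<pi} (\<lambda>R. eta m R * sin (R / 2))"
      using eta_1_sin_half unfolding m1 by blast
    have sub: "{0<..<R\<^sub>1} \<subseteq> {0<..<pi}" "{R\<^sub>1<..<pi} \<subseteq> {0<..<pi}" using R\<^sub>1(1) by auto
    show ?thesis
      by (rule bexI[OF _ R\<^sub>1(1)], rule conjI[OF cong[OF sub(1) R\<^sub>1(2)] cong[OF sub(2) R\<^sub>1(3)]])
  qed
  then show ?thesis
    by (intro conjI impI cong[OF subset_refl] eta_id_increasing eta_sin_decreasing
        eta_tan_increasing eta_sin_half_increasing assms(2))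
qed

end
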